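(* Let $D\subset\mathbb{R}^2$ be the interior of an equilateral triangle. Let $u$ be an eigenfunction of the Neumann Laplacian on $D$ (for any eigenvalue $\mu\ge 0$). If $u\ge 0$ at every point of $\partial D$, then $u$ is constant in $D$.
   Context: A Neumann eigenfunction on $D$ is a real-valued, not identically zero function $u\in H^1(D)$ such that for some $\mu\in\mathbb{R}$ one has $\int_D\nabla u\cdot\nabla v=\mu\int_D uv$ for all $v\in H^1(D)$ (equivalently $\Delta u=-\mu u$ in $D$, $\partial_\nu u=0$ on $\partial D$). Such eigenfunctions extend continuously to $\overline D$, and boundary values refer to this extension. *)

theory Defs
  imports "HOL-Analysis.Analysis"
begin

definition partial :: "'n::finite \<Rightarrow> (real^'n \<Rightarrow> real) \<Rightarrow> real^'n \<Rightarrow> real" where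
  "partial i f x = frechet_derivative f (at x) (axis i 1)"

primrec C_class :: "nat \<Rightarrow> (real^'n::finite \<Rightarrow> real) \<Rightarrow> bool" where
  "C_class 0 f \<longleftrightarrow> continuous_on UNIV f"
| "C_class (Suc k) f \<longleftrightarrow> (\<forall>x. f differentiable (at x)) \<and> (\<forall>i. C_class k (partial i f))"

definition test_function :: "(real^'n::finite) set \<Rightarrow> (real^'n \<Rightarrow> real) \<Rightarrow> bool" where
  "test_function D \<phi> \<longleftrightarrow> (\<forall>k. C_class k \<phi>) \<and>
     compact (closure {x. \<phi> x \<noteq> 0}) \<and> closure {x. \<phi> x \<noteq> 0} \<subseteq> D"

definition L2_on :: "(real^'n::finite) set \<Rightarrow> (real^'n \<Rightarrow> 'b::euclidean_space) \<Rightarrow> bool" where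
  "L2_on D f \<longleftrightarrow> f \<in> borel_measurable (lebesgue_on D) \<and>
     integrable (lebesgue_on D) (\<lambda>x. (norm (f x))\<^sup>2)"

definition weak_gradient :: "(real^'n::finite) set \<Rightarrow> (real^'n \<Rightarrow> real) \<Rightarrow> (real^'n \<Rightarrow> real^'n) \<Rightarrow> bool" where
  "weak_gradient D u g \<longleftrightarrow> (\<forall>\<phi> i. test_function D \<phi> \<longrightarrow>
     (LINT x|lebesgue_on D. u x * partial i \<phi> x) = - (LINT x|lebesgue_on D. g x $ i * \<phi> x))"

(* Functions in H^1(D) are represented by functions on the whole space; only their values
   almost everywhere on D matter.  The weak gradient g, being unique only up to null sets,
   is carried along as an argument: H1_gradient D u g means that u is in H^1(D) and
   \<nabla>u = g almost everywhere. *)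
definition H1_gradient :: "(real^'n::finite) set \<Rightarrow> (real^'n \<Rightarrow> real) \<Rightarrow> (real^'n \<Rightarrow> real^'n) \<Rightarrow> bool" where
  "H1_gradient D u g \<longleftrightarrow> L2_on D u \<and> L2_on D g \<and> weak_gradient D u g"

definition neumann_eigenfunction :: "(real^'n::finite) set \<Rightarrow> (real^'n \<Rightarrow> real) \<Rightarrow> bool" where
  "neumann_eigenfunction D u \<longleftrightarrow>
     \<not> (AE x in lebesgue_on D. u x = 0) \<and>
     (\<exists>g \<mu>. H1_gradient D u g \<and>
       (\<forall>v h. H1_gradient D v h \<longrightarrow>
         (LINT x|lebesgue_on D. g x \<bullet> h x) = \<mu> * (LINT x|lebesgue_on D. u x * v x)))"

(* w is the continuous extension to the closure of the class of u; its values outside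
   the closure of D are irrelevant. *)
definition continuous_extension ::
    "(real^'n::finite) set \<Rightarrow> (real^'n \<Rightarrow> real) \<Rightarrow> (real^'n \<Rightarrow> real) \<Rightarrow> bool" where
  "continuous_extension D u w \<longleftrightarrow>
     continuous_on (closure D) w \<and> (AE x in lebesgue_on D. w x = u x)"

definition equilateral_triangle :: "(real^2) set \<Rightarrow> bool" where
  "equilateral_triangle T \<longleftrightarrow> (\<exists>a b c. a \<noteq> b \<and> dist a b = dist b c \<and> dist b c = dist c a \<and>
     T = convex hull {a, b, c})"

end

theory Submission
  imports Defs
begin

text \<open>
  Write \<open>d\<^sub>i\<close> for the distance to the \<open>i\<close>-th side and \<open>m\<^sub>i\<close> for the inward unit normal of that
  side. The proof rests on one explicit solution of the Helmholtz equation. For \<open>\<mu> = k\<^sup>2 > 0\<close> put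
  \<open>v = (\<Sum>i. sin (k d\<^sub>i))\<close>, so that \<open>\<Delta>v = - \<mu> v\<close>. Since \<open>m\<^sub>i \<bullet> m\<^sub>j = - 1/2\<close> for \<open>i \<noteq> j\<close>, the inward
  normal derivative of \<open>v\<close> on the side \<open>d\<^sub>j = 0\<close> is \<open>k/2\<close> times \<open>\<Sum>i\<noteq>j. (1 - cos (k d\<^sub>i))\<close>; it is
  nonnegative and vanishes at finitely many points only. Green's formula for the two solutions \<open>w\<close>
  (the continuous representative of \<open>u\<close>) and \<open>v\<close>, together with the Neumann condition for \<open>w\<close>,
  says that \<open>w\<close> times this normal derivative has integral \<open>0\<close> over the boundary. If \<open>w\<close> is nonnegative there, it must vanish on the whole
  boundary (\<open>boundary_zero\<close>).

  An eigenfunction with \<open>\<mu> > 0\<close> cannot have vanishing boundary values: Green's formula with the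
  exponentials \<open>exp (\<xi> \<bullet> x)\<close> then has no boundary term and gives \<open>(\<bar>\<xi>\<bar>\<^sup>2 + \<mu>) * (\<integral> w exp (\<xi> \<bullet> x)) = 0\<close>,
  so \<open>w\<close> is orthogonal to all real exponentials, and these are dense by the Stone-Weierstrass
  theorem (\<open>orthogonal_to_exponentials_imp_AE_zero\<close>). If \<open>\<mu> \<le> 0\<close>, testing with \<open>u\<close> itself shows that the
  gradient of \<open>u\<close> vanishes, and \<open>u\<close> is constant (\<open>weak_gradient_zero_imp_constant\<close>).

  Integrals over the boundary are represented as limits of integrals over \<open>D\<close> against the densities
  \<open>layer n i\<close>, which are nonnegative and concentrate at the \<open>i\<close>-th side as \<open>n\<close> grows. The densities
  come from the gradient of an explicit product cutoff, so that Green's formula in the limit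
  (\<open>tendsto_boundary_flux\<close>) is nothing but the definition of the weak gradient applied to a cutoff
  times a smooth function. Two estimates are all that is needed of these densities: their total
  masses stay bounded, and \<open>d\<^sub>i\<close> times the density tends to \<open>0\<close> in mean. Hence a continuous function
  that is nonnegative on a side has asymptotically nonnegative integrals (\<open>eventually_layer_int_ge\<close>),
  which stay away from \<open>0\<close> if it is positive somewhere on the side (\<open>layer_int_bounded_below\<close>).
\<close>

section \<open>Smooth functions\<close>

definition smooth :: "(real^'n::finite \<Rightarrow> real) \<Rightarrow> bool" where
  "smooth f \<longleftrightarrow> (\<forall>k. C_class k f)"

definition dirderiv :: "'a::real_normed_vector \<Rightarrow> ('a \<Rightarrow> real) \<Rightarrow> 'a \<Rightarrow> real" where
  "dirderiv e f x = frechet_derivative f (at x) e"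

lemma dirderiv_eq: "(f has_derivative f') (at x) \<Longrightarrow> dirderiv e f x = f' e"
  unfolding dirderiv_def using frechet_derivative_at by metis

lemma partial_eq_dirderiv: "partial i f = dirderiv (axis i 1) f"
  by (auto simp: partial_def dirderiv_def)

lemma dirderiv_eq_sum_partial:
  fixes f :: "real^'n::finite \<Rightarrow> real"
  assumes "f differentiable (at x)"
  shows "dirderiv e f x = (\<Sum>i\<in>UNIV. e $ i * partial i f x)"
proof -
  have lin: "linear (frechet_derivative f (at x))"
    using assms by (simp add: linear_frechet_derivative)
  have "frechet_derivative f (at x) e = frechet_derivative f (at x) (\<Sum>i\<in>UNIV. e $ i *\<^sub>R axis i 1)"
    by (simp only: basis_expansion[of e, unfolded scalar_mult_eq_scaleR])
  also have "\<dots> = (\<Sum>i\<in>UNIV. e $ i * frechet_derivative f (at x) (axis i 1))"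
    by (simp add: linear_sum[OF lin] linear_scale[OF lin])
  finally show ?thesis by (simp add: dirderiv_def partial_def)
qed

lemma C_class_continuous: "C_class k f \<Longrightarrow> continuous_on UNIV f"
  by (cases k) (auto intro: differentiable_imp_continuous_on simp: differentiable_on_def)

lemma C_class_SucD: "C_class (Suc k) f \<Longrightarrow> C_class k f"
proof (induction k arbitrary: f)
  case 0 then show ?case using C_class_continuous by fastforce
next
  case (Suc k) then show ?case by auto
qed

lemma partial_const: "partial i (\<lambda>x. c) = (\<lambda>x. 0)"
  by (auto simp: partial_def)

lemma C_class_const: "C_class k (\<lambda>x. c)"
  by (induction k arbitrary: c) (auto simp: partial_const)

lemma partial_inner: "partial i (\<lambda>x. x \<bullet> a) = (\<lambda>x. a $ i)"
  unfolding partial_eq_dirderiv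
  by (rule ext, subst dirderiv_eq[where f' = "\<lambda>h. h \<bullet> a"])
     (auto intro!: derivative_eq_intros simp: inner_axis')

lemma C_class_inner: "C_class k (\<lambda>x. x \<bullet> a)"
  by (cases k) (auto simp: partial_inner C_class_const bounded_linear_imp_differentiable bounded_linear_inner_left
      intro!: linear_continuous_on)

lemma partial_add:
  assumes "\<And>x. f differentiable (at x)" "\<And>x. g differentiable (at x)"
  shows "partial i (\<lambda>x. f x + g x) = (\<lambda>x. partial i f x + partial i g x)"
  unfolding partial_def
  by (rule ext, rule dirderiv_eq[OF has_derivative_add, OF assms[unfolded frechet_derivative_works],
        unfolded dirderiv_def, THEN trans]) (simp add: add.commute)

lemma C_class_add: "C_class k f \<Longrightarrow> C_class k g \<Longrightarrow> C_class k (\<lambda>x. f x + g x)"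
proof (induction k arbitrary: f g)
  case 0 then show ?case by (simp add: continuous_on_add)
next
  case (Suc k)
  have d: "\<And>x. f differentiable (at x)" "\<And>x. g differentiable (at x)"
    using Suc.prems by auto
  have "C_class k (partial i (\<lambda>x. f x + g x))" for i
    unfolding partial_add[OF d] by (rule Suc.IH) (use Suc.prems in auto)
  then show ?case using d by (simp add: differentiable_add)
qed

lemma partial_mult:
  assumes "\<And>x. f differentiable (at x)" "\<And>x. g differentiable (at x)"
  shows "partial i (\<lambda>x. f x * g x) = (\<lambda>x. partial i f x * g x + f x * partial i g x)"
  unfolding partial_def
  by (rule ext, rule dirderiv_eq[OF has_derivative_mult, OF assms[unfolded frechet_derivative_works],
        unfolded dirderiv_def, THEN trans]) (simp add: add.commute)

lemma C_class_mult: "C_class k f \<Longrightarrow> C_class k g \<Longrightarrow> C_class k (\<lambda>x. f x * g x)"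
proof (induction k arbitrary: f g)
  case 0 then show ?case by (auto intro!: continuous_on_mult)
next
  case (Suc k)
  have d: "\<And>x. f differentiable (at x)" "\<And>x. g differentiable (at x)"
    using Suc.prems by auto
  have "C_class k (partial i (\<lambda>x. f x * g x))" for i
    unfolding partial_mult[OF d]
    using Suc.prems[THEN C_class_SucD] Suc.prems
    by (intro C_class_add Suc.IH) auto
  then show ?case using d by (auto intro!: differentiable_mult)
qed

text \<open>
  A set of functions of one variable that is closed under taking derivatives consists of smooth
  functions; the chain rule propagates this closure to the compositions by induction on the order.
\<close>

lemma C_class_compose:
  fixes S :: "(real \<Rightarrow> real) set"
  assumes S: "\<And>F. F \<in> S \<Longrightarrow> \<exists>F'\<in>S. \<forall>s. (F has_real_derivative F' s) (at s)"
  shows "F \<in> S \<Longrightarrow> C_class k h \<Longrightarrow> C_class k (\<lambda>x. F (h x))"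
proof (induction k arbitrary: F)
  case 0
  obtain F' where F': "\<And>s. (F has_real_derivative F' s) (at s)" using S 0 by blast
  then have "continuous_on UNIV F"
    using DERIV_continuous_on by blast
  with 0 show ?case
    by (auto intro: continuous_on_compose2)
next
  case (Suc k)
  obtain F' where F': "F' \<in> S" "\<And>s. (F has_real_derivative F' s) (at s)" using S Suc.prems by blast
  have d: "h differentiable (at x)" for x using Suc.prems by auto
  have D: "((\<lambda>x. F (h x)) has_derivative (\<lambda>e. frechet_derivative h (at x) e * F' (h x))) (at x)" for x
    using has_derivative_compose[OF d[of x, unfolded frechet_derivative_works]
        F'(2)[of "h x", unfolded has_field_derivative_def]] by (simp add: mult.commute)
  have "partial i (\<lambda>x. F (h x)) = (\<lambda>x. partial i h x * F' (h x))" for i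
    unfolding partial_def by (rule ext) (rule dirderiv_eq[OF D, unfolded dirderiv_def])
  moreover have "C_class k (\<lambda>x. partial i h x * F' (h x))" for i
    using C_class_SucD[OF Suc.prems(2)] Suc.prems(2)
    by (intro C_class_mult Suc.IH[OF F'(1)]) auto
  moreover have "(\<lambda>x. F (h x)) differentiable (at x)" for x
    using D[of x] unfolding differentiable_def by blast
  ultimately show ?case by simp
qed

lemma smooth_const: "smooth (\<lambda>x. c)"
  and smooth_inner: "smooth (\<lambda>x. x \<bullet> a)"
  by (auto simp: smooth_def C_class_const C_class_inner)

lemma smooth_add: "smooth f \<Longrightarrow> smooth g \<Longrightarrow> smooth (\<lambda>x. f x + g x)"
  and smooth_mult: "smooth f \<Longrightarrow> smooth g \<Longrightarrow> smooth (\<lambda>x. f x * g x)"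
  by (auto simp: smooth_def C_class_add C_class_mult)

lemma smooth_sum: "(\<And>i. i \<in> A \<Longrightarrow> smooth (f i)) \<Longrightarrow> smooth (\<lambda>x. \<Sum>i\<in>A. f i x)"
  by (induction A rule: infinite_finite_induct) (auto simp: smooth_const intro: smooth_add)

lemma smooth_prod: "(\<And>i. i \<in> A \<Longrightarrow> smooth (f i)) \<Longrightarrow> smooth (\<lambda>x. \<Prod>i\<in>A. f i x)"
  by (induction A rule: infinite_finite_induct) (auto simp: smooth_const intro: smooth_mult)

lemma smooth_compose:
  assumes "\<And>F. F \<in> S \<Longrightarrow> \<exists>F'\<in>S. \<forall>s. (F has_real_derivative F' s) (at s)" "F \<in> S" "smooth h"
  shows "smooth (\<lambda>x. F (h x))"
  unfolding smooth_def
proof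
  fix k show "C_class k (\<lambda>x. F (h x))"
    by (rule C_class_compose[OF assms(1,2)]) (use assms(3) in \<open>auto simp: smooth_def\<close>)
qed

lemma smooth_exp: "smooth h \<Longrightarrow> smooth (\<lambda>x. exp (h x))"
  by (rule smooth_compose[where S = "{exp}"]) (auto intro!: derivative_eq_intros)

text \<open>
  The shifts of the sine are closed under differentiation, which covers the cosine as well.
\<close>

lemma smooth_sin_shift: "smooth h \<Longrightarrow> smooth (\<lambda>x. sin (h x + a))"
proof (rule smooth_compose[where S = "range (\<lambda>a s. sin (s + a))" and F = "\<lambda>s. sin (s + a)"])
  fix F :: "real \<Rightarrow> real" assume "F \<in> range (\<lambda>a s. sin (s + a))"
  then obtain a where F: "F = (\<lambda>s. sin (s + a))" by blast
  have "(F has_real_derivative sin (s + (a + pi / 2))) (at s)" for s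
    unfolding F by (auto intro!: derivative_eq_intros simp: add.assoc[symmetric] sin_add[of "s + a" "pi / 2"])
  then show "\<exists>F'\<in>range (\<lambda>a s. sin (s + a)). \<forall>s. (F has_real_derivative F' s) (at s)"
    by (intro bexI[of _ "\<lambda>s. sin (s + (a + pi / 2))"]) auto
qed auto

lemma smooth_sin: "smooth h \<Longrightarrow> smooth (\<lambda>x. sin (h x))"
  using smooth_sin_shift[of h 0] by simp

lemma smooth_cos: "smooth h \<Longrightarrow> smooth (\<lambda>x. cos (h x))"
  using smooth_sin_shift[of h "pi / 2"] by (simp add: sin_add)

lemma smooth_differentiable: "smooth f \<Longrightarrow> f differentiable (at x)"
  unfolding smooth_def using C_class.simps(2) by blast

lemma smooth_partial: "smooth f \<Longrightarrow> smooth (partial i f)"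
  unfolding smooth_def using C_class.simps(2) by blast

lemma smooth_continuous: "smooth f \<Longrightarrow> continuous_on A f"
  unfolding smooth_def using C_class_continuous continuous_on_subset subset_UNIV by blast

lemma smooth_dirderiv: "smooth f \<Longrightarrow> smooth (dirderiv e f)"
proof -
  assume f: "smooth f"
  then have "dirderiv e f = (\<lambda>x. \<Sum>i\<in>UNIV. e $ i * partial i f x)"
    by (auto simp: dirderiv_eq_sum_partial smooth_differentiable)
  with f show ?thesis by (simp add: smooth_sum smooth_mult smooth_const smooth_partial)
qed

lemma smooth_has_derivative: "smooth f \<Longrightarrow> (f has_derivative (\<lambda>e. dirderiv e f x)) (at x)"
  unfolding dirderiv_def using smooth_differentiable frechet_derivative_works by fastforce

lemma dirderiv_mult:
  assumes "smooth f" "smooth g"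
  shows "dirderiv e (\<lambda>x. f x * g x) x = dirderiv e f x * g x + f x * dirderiv e g x"
  by (subst dirderiv_eq[OF has_derivative_mult[OF smooth_has_derivative smooth_has_derivative]])
     (use assms in auto)

section \<open>A smooth function that is flat at the origin\<close>

text \<open>
  The functions \<open>p (1/s) exp (- 1/s)\<close>, continued by \<open>0\<close> to \<open>s \<le> 0\<close>. All derivatives of
  \<open>exp (- 1/s)\<close> have this form, so the whole family is treated at once.
\<close>

definition flat :: "real poly \<Rightarrow> real \<Rightarrow> real" where
  "flat p s = (if s > 0 then poly p (1 / s) * exp (- 1 / s) else 0)"

lemma flat_tendsto_0: "(flat p \<longlongrightarrow> 0) (at 0)"
proof -
  have "((\<lambda>y. poly p y / exp y) \<longlongrightarrow> 0) at_top"
  proof -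
    have "((\<lambda>y::real. \<Sum>i\<le>degree p. coeff p i * (y ^ i / exp y)) \<longlongrightarrow> (\<Sum>i\<le>degree p. coeff p i * 0)) at_top"
      by (intro tendsto_intros tendsto_power_div_exp_0)
    then show ?thesis by (simp add: poly_altdef sum_divide_distrib)
  qed
  then have "((\<lambda>s. poly p (inverse s) / exp (inverse s)) \<longlongrightarrow> 0) (at_right 0)"
    by (rule filterlim_compose[OF _ filterlim_inverse_at_top_right])
  then have R: "(flat p \<longlongrightarrow> 0) (at_right 0)"
    by (rule Lim_transform_eventually)
      (auto simp: flat_def eventually_at_filter divide_inverse exp_minus)
  have "(flat p \<longlongrightarrow> 0) (at_left 0)"
    by (rule tendsto_eventually) (auto simp: flat_def eventually_at_filter)
  with R show ?thesis by (simp add: filterlim_split_at)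
qed

lemma flat_deriv:
  "(flat p has_real_derivative flat ([:0, 0, 1:] * (p - pderiv p)) s) (at s)"
proof -
  consider "s > 0" | "s < 0" | "s = 0" by linarith
  then show ?thesis
  proof cases
    case 1
    have "((\<lambda>s. poly p (1 / s) * exp (- 1 / s)) has_real_derivative flat ([:0, 0, 1:] * (p - pderiv p)) s) (at s)"
      using 1 by (auto intro!: derivative_eq_intros DERIV_chain2[OF poly_DERIV] simp: flat_def field_simps power2_eq_square)
    moreover have "\<forall>\<^sub>F t in nhds s. flat p t = poly p (1 / t) * exp (- 1 / t)"
      using eventually_nhds_in_open[of "{0<..}" s] 1 by (auto elim!: eventually_mono simp: flat_def)
    ultimately show ?thesis by (subst DERIV_cong_ev) auto
  next
    case 2
    have "\<forall>\<^sub>F t in nhds s. flat p t = 0"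
      using eventually_nhds_in_open[of "{..<0}" s] 2 by (auto elim!: eventually_mono simp: flat_def)
    with 2 show ?thesis by (subst DERIV_cong_ev[where g = "\<lambda>_. 0"]) (auto simp: flat_def)
  next
    case 3
    have "((\<lambda>h. flat p h / h) \<longlongrightarrow> 0) (at 0)"
      by (rule Lim_transform_eventually[OF flat_tendsto_0[of "pCons 0 p"]])
        (auto simp: flat_def eventually_at_filter)
    with 3 show ?thesis by (simp add: DERIV_def flat_def)
  qed
qed

lemma smooth_flat: "smooth h \<Longrightarrow> smooth (\<lambda>x. flat p (h x))"
  by (rule smooth_compose[where S = "range flat"]) (use flat_deriv in auto)

lemma flat_1_bounds: "0 \<le> flat 1 s" "flat 1 s \<le> 1"
  by (auto simp: flat_def)

lemma flat_nonneg: "0 \<le> flat [:0, 0, 1:] s"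
  by (simp add: flat_def)

text \<open>
  The derivative \<open>flat [:0, 0, 1:]\<close> of \<open>flat 1\<close> decays like \<open>1/s\<^sup>2\<close>. The factor \<open>s + 1\<close> becomes a scaled
  distance once \<open>s\<close> is a scaled distance minus \<open>1\<close>.
\<close>

lemma mult_flat_deriv_le: "(s + 1) * flat [:0, 0, 1:] s \<le> 2"
proof (cases "s > 0")
  case True
  define y where "y = 1 / s"
  have y: "y > 0" using True by (simp add: y_def)
  have "y + y\<^sup>2 \<le> 2 * exp y"
    using exp_lower_Taylor_quadratic[of y] y by (auto simp: power2_eq_square)
  then have "(y + y\<^sup>2) * exp (- y) \<le> 2" by (simp add: exp_minus field_simps)
  moreover have "(s + 1) * flat [:0, 0, 1:] s = (y + y\<^sup>2) * exp (- y)"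
    using True by (simp add: flat_def y_def field_simps power2_eq_square)
  ultimately show ?thesis by simp
qed (simp add: flat_def)

lemma flat_deriv_le: "s > 0 \<Longrightarrow> flat [:0, 0, 1:] s \<le> 1 / s\<^sup>2"
  by (auto simp: flat_def power2_eq_square intro!: divide_right_mono)

section \<open>Test functions and integration by parts\<close>

lemma smooth_test_function: "test_function D \<phi> \<Longrightarrow> smooth \<phi>"
  by (simp add: test_function_def smooth_def)

lemma dirderiv_outside_support:
  assumes "x \<notin> closure {x. \<phi> x \<noteq> 0}"
  shows "dirderiv e \<phi> x = 0"
proof -
  have "(\<phi> has_derivative (\<lambda>_. 0)) (at x)"
  proof (rule has_derivative_transform_within_open[where f = "\<lambda>_. 0" and s = "- closure {x. \<phi> x \<noteq> 0}"])
    fix y assume "y \<in> - closure {x. \<phi> x \<noteq> 0}"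
    then show "0 = \<phi> y" using closure_subset[of "{x. \<phi> x \<noteq> 0}"] by auto
  qed (use assms in auto)
  then show ?thesis by (simp add: dirderiv_eq)
qed

lemma smooth_has_derivative_along:
  assumes "smooth \<phi>"
  shows "((\<lambda>t. \<phi> (x + t *\<^sub>R e)) has_real_derivative dirderiv e \<phi> (x + t *\<^sub>R e)) (at t)"
proof -
  have 1: "((\<lambda>t. x + t *\<^sub>R e) has_derivative (\<lambda>h. h *\<^sub>R e)) (at t)"
    by (auto intro!: derivative_eq_intros)
  have "((\<lambda>t. \<phi> (x + t *\<^sub>R e)) has_derivative (\<lambda>h. dirderiv (h *\<^sub>R e) \<phi> (x + t *\<^sub>R e))) (at t)"
    by (rule has_derivative_compose[OF 1 smooth_has_derivative[OF assms]])
  moreover have "dirderiv (h *\<^sub>R e) \<phi> y = h * dirderiv e \<phi> y" for h y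
    using linear_scale[OF linear_frechet_derivative[OF smooth_differentiable[OF assms, of y]], of h e]
    by (simp add: dirderiv_def)
  ultimately show ?thesis by (simp add: has_field_derivative_def mult.commute[of "dirderiv _ _ _"] mult_commute_abs)
qed

lemma continuous_zero_outside_compact_bounded:
  fixes f :: "'a::t2_space \<Rightarrow> real"
  assumes "continuous_on UNIV f" "compact K" "\<And>x. x \<notin> K \<Longrightarrow> f x = 0"
  obtains C where "\<And>x. \<bar>f x\<bar> \<le> C"
proof -
  have "compact (f ` K)"
    using assms by (intro compact_continuous_image) (auto intro: continuous_on_subset)
  then obtain C where "\<And>y. y \<in> f ` K \<Longrightarrow> norm y \<le> C"
    using compact_imp_bounded bounded_iff by metis
  then have "\<bar>f x\<bar> \<le> max C 0" for x
    using assms(3)[of x] by (cases "x \<in> K") fastforce+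
  then show ?thesis using that by blast
qed

lemma integrable_mult_bounded:
  fixes f h :: "'a \<Rightarrow> real"
  assumes "integrable M f" "h \<in> borel_measurable M" "\<And>x. x \<in> space M \<Longrightarrow> \<bar>h x\<bar> \<le> C"
  shows "integrable M (\<lambda>x. f x * h x)"
proof (rule Bochner_Integration.integrable_bound)
  show "integrable M (\<lambda>x. C * \<bar>f x\<bar>)" using assms(1) by auto
  show "(\<lambda>x. f x * h x) \<in> borel_measurable M"
    using assms by measurable
  show "AE x in M. norm (f x * h x) \<le> norm (C * \<bar>f x\<bar>)"
  proof (rule AE_I2)
    fix x assume "x \<in> space M"
    then have "\<bar>f x\<bar> * \<bar>h x\<bar> \<le> \<bar>f x\<bar> * \<bar>C\<bar>"
      using assms(3)[of x] by (intro mult_left_mono) auto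
    then show "norm (f x * h x) \<le> norm (C * \<bar>f x\<bar>)" by (simp add: abs_mult mult.commute)
  qed
qed

lemma borel_measurable_lebesgue_continuous:
  fixes f :: "'a::euclidean_space \<Rightarrow> real"
  shows "continuous_on UNIV f \<Longrightarrow> f \<in> borel_measurable lebesgue"
  by (simp add: borel_measurable_continuous_onI measurable_completion)

text \<open>
  Translating a compactly supported smooth function moves its values at bounded speed, so that
  dominated convergence permits differentiation under the integral sign.
\<close>

lemma DERIV_integral_translate:
  fixes W \<phi> :: "real^'n::finite \<Rightarrow> real"
  assumes W: "integrable lebesgue W" and \<phi>: "smooth \<phi>" "compact (closure {x. \<phi> x \<noteq> 0})"
  shows "((\<lambda>t. LINT x|lebesgue. W x * \<phi> (x + t *\<^sub>R e)) has_real_derivative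
           (LINT x|lebesgue. W x * dirderiv e \<phi> (x + t *\<^sub>R e))) (at t)"
proof -
  obtain B where B: "\<bar>\<phi> x\<bar> \<le> B" for x
    by (rule continuous_zero_outside_compact_bounded[OF smooth_continuous[OF \<phi>(1)] \<phi>(2)])
       (use closure_subset[of "{x. \<phi> x \<noteq> 0}"] in auto)
  obtain C where C: "\<bar>dirderiv e \<phi> x\<bar> \<le> C" for x
    using continuous_zero_outside_compact_bounded[OF smooth_continuous[OF smooth_dirderiv[OF \<phi>(1)]] \<phi>(2)]
      dirderiv_outside_support by metis
  have cont: "continuous_on UNIV (\<lambda>x. \<phi> (x + t *\<^sub>R e))" for t
    by (rule continuous_on_compose2[OF smooth_continuous[OF \<phi>(1), of UNIV]]) (auto intro!: continuous_intros)
  have cont': "continuous_on UNIV (\<lambda>x. dirderiv e \<phi> (x + t *\<^sub>R e))" for t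
    by (rule continuous_on_compose2[OF smooth_continuous[OF smooth_dirderiv[OF \<phi>(1)], of UNIV]]) (auto intro!: continuous_intros)
  have int: "integrable lebesgue (\<lambda>x. W x * \<phi> (x + t *\<^sub>R e))" for t
    by (rule integrable_mult_bounded[OF W borel_measurable_lebesgue_continuous[OF cont] B])
  have int': "integrable lebesgue (\<lambda>x. W x * dirderiv e \<phi> (x + t *\<^sub>R e))" for t
    by (rule integrable_mult_bounded[OF W borel_measurable_lebesgue_continuous[OF cont'] C])
  have Lip: "\<bar>\<phi> (x + (t + h) *\<^sub>R e) - \<phi> (x + t *\<^sub>R e)\<bar> \<le> C * \<bar>h\<bar>" for x h
  proof -
    have "norm (\<phi> (x + (t + h) *\<^sub>R e) - \<phi> (x + t *\<^sub>R e)) \<le> C * norm ((t + h) - t)"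
      by (rule field_differentiable_bound[where S = UNIV and f = "\<lambda>t. \<phi> (x + t *\<^sub>R e)" and f' = "\<lambda>t. dirderiv e \<phi> (x + t *\<^sub>R e)"])
         (auto intro: smooth_has_derivative_along[OF \<phi>(1)] simp: C)
    then show ?thesis by simp
  qed
  show ?thesis
    unfolding DERIV_def tendsto_at_iff_sequentially
  proof (intro allI impI)
    fix X :: "nat \<Rightarrow> real" assume X: "\<forall>i. X i \<in> UNIV - {0}" "X \<longlonglongrightarrow> 0"
    let ?q = "\<lambda>n x. W x * ((\<phi> (x + (t + X n) *\<^sub>R e) - \<phi> (x + t *\<^sub>R e)) / X n)"
    have "(\<lambda>n. integral\<^sup>L lebesgue (?q n)) \<longlonglongrightarrow> (LINT x|lebesgue. W x * dirderiv e \<phi> (x + t *\<^sub>R e))"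
    proof (rule integral_dominated_convergence[where w = "\<lambda>x. C * \<bar>W x\<bar>"])
      show "(\<lambda>x. W x * dirderiv e \<phi> (x + t *\<^sub>R e)) \<in> borel_measurable lebesgue" using int' by auto
      have eq: "?q n = (\<lambda>x. (W x * \<phi> (x + (t + X n) *\<^sub>R e) - W x * \<phi> (x + t *\<^sub>R e)) / X n)" for n
        by (auto simp: algebra_simps)
      show "?q n \<in> borel_measurable lebesgue" for n
        unfolding eq using borel_measurable_integrable[OF int] by measurable
      show "integrable lebesgue (\<lambda>x. C * \<bar>W x\<bar>)" using W by auto
      show "AE x in lebesgue. norm (?q n x) \<le> C * \<bar>W x\<bar>" for n
      proof (rule AE_I2)
        fix x
        have "\<bar>(\<phi> (x + (t + X n) *\<^sub>R e) - \<phi> (x + t *\<^sub>R e)) / X n\<bar> \<le> C"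
          using Lip[of x "X n"] X(1) by (simp add: abs_divide divide_le_eq)
        then show "norm (?q n x) \<le> C * \<bar>W x\<bar>"
          by (simp only: real_norm_def abs_mult mult.commute[of C]) (rule mult_left_mono, auto)
      qed
      show "AE x in lebesgue. (\<lambda>n. ?q n x) \<longlonglongrightarrow> W x * dirderiv e \<phi> (x + t *\<^sub>R e)"
      proof (rule AE_I2)
        fix x
        show "(\<lambda>n. ?q n x) \<longlonglongrightarrow> W x * dirderiv e \<phi> (x + t *\<^sub>R e)"
          using smooth_has_derivative_along[OF \<phi>(1), of x e t] X
          unfolding DERIV_def tendsto_at_iff_sequentially by (intro tendsto_intros) (auto simp: o_def)
      qed
    qed
    moreover have "integral\<^sup>L lebesgue (?q n) = ((LINT x|lebesgue. W x * \<phi> (x + (t + X n) *\<^sub>R e)) - (LINT x|lebesgue. W x * \<phi> (x + t *\<^sub>R e))) / X n" for n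
      by (subst Bochner_Integration.integral_diff[symmetric, OF int int])
         (simp add: right_diff_distrib flip: integral_divide_zero)
    ultimately show "((\<lambda>h. ((LINT x|lebesgue. W x * \<phi> (x + (t + h) *\<^sub>R e)) - (LINT x|lebesgue. W x * \<phi> (x + t *\<^sub>R e))) / h) \<circ> X)
        \<longlonglongrightarrow> (LINT x|lebesgue. W x * dirderiv e \<phi> (x + t *\<^sub>R e))"
      by (simp only: o_def)
  qed
qed

lemma integral_lebesgue_translate:
  fixes f :: "'a::euclidean_space \<Rightarrow> real"
  assumes [measurable]: "f \<in> borel_measurable borel"
  shows "(LINT x|lebesgue. f (x + c)) = (LINT x|lebesgue. f x)"
proof -
  have "(LINT x|lebesgue. f (x + c)) = (LINT x|lborel. f (c + x))"
    by (subst integral_completion) (auto simp: add.commute)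
  also have "\<dots> = integral\<^sup>L (distr lborel borel ((+) c)) f"
    by (subst integral_distr) auto
  also have "\<dots> = (LINT x|lebesgue. f x)"
    by (simp add: lborel_distr_plus integral_completion)
  finally show ?thesis .
qed

text \<open>
  The integral of \<open>\<phi>\<close> is invariant under translation, hence its derivative along the translation
  vanishes.
\<close>

lemma integral_dirderiv_compact_support:
  fixes \<phi> :: "real^'n::finite \<Rightarrow> real"
  assumes \<phi>: "smooth \<phi>" "compact (closure {x. \<phi> x \<noteq> 0})"
  shows "(LINT x|lebesgue. dirderiv e \<phi> x) = 0"
proof -
  obtain R where R: "\<And>x. x \<in> closure {x. \<phi> x \<noteq> 0} \<Longrightarrow> norm x \<le> R"
    using compact_imp_bounded[OF \<phi>(2)] bounded_iff by metis
  \<comment> \<open>The weight has to be integrable; on this ball it does not alter the translates by \<open>t e\<close> with \<open>\<bar>t\<bar> < 1\<close>.\<close>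
  define W :: "real^'n \<Rightarrow> real" where "W = indicator (cball 0 (R + norm e))"
  have W: "integrable lebesgue W"
    unfolding W_def by (rule integrable_real_indicator) (auto intro: emeasure_bounded_finite simp flip: infinity_ennreal_def)
  have 1: "W x * \<phi> (x + t *\<^sub>R e) = \<phi> (x + t *\<^sub>R e)" if "\<bar>t\<bar> < 1" for x t
  proof (cases "\<phi> (x + t *\<^sub>R e) = 0")
    case False
    then have "norm (x + t *\<^sub>R e) \<le> R" using R closure_subset[of "{x. \<phi> x \<noteq> 0}"] by blast
    moreover have "norm x \<le> norm (x + t *\<^sub>R e) + norm (t *\<^sub>R e)"
      using norm_triangle_ineq4[of "x + t *\<^sub>R e" "t *\<^sub>R e"] by simp
    moreover have "norm (t *\<^sub>R e) \<le> norm e"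
      using that by (simp add: mult_left_le_one_le)
    ultimately show ?thesis by (simp add: W_def)
  qed auto
  have 2: "W x * dirderiv e \<phi> x = dirderiv e \<phi> x" for x
  proof (cases "x \<in> closure {x. \<phi> x \<noteq> 0}")
    case True then show ?thesis using R[OF True] by (simp add: W_def add_increasing2)
  qed (simp add: dirderiv_outside_support)
  have m: "\<phi> \<in> borel_measurable borel"
    using smooth_continuous[OF \<phi>(1)] by (rule borel_measurable_continuous_onI)
  have "((\<lambda>t. LINT x|lebesgue. W x * \<phi> (x + t *\<^sub>R e)) has_real_derivative (LINT x|lebesgue. dirderiv e \<phi> x)) (at 0)"
    using DERIV_integral_translate[OF W \<phi>, of e 0] by (simp add: 2)
  moreover have "((\<lambda>t. LINT x|lebesgue. W x * \<phi> (x + t *\<^sub>R e)) has_real_derivative 0) (at 0)"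
  proof (rule has_field_derivative_transform_within_open[where f = "\<lambda>t. LINT x|lebesgue. \<phi> x" and S = "{-1<..<1}"])
    fix t :: real assume "t \<in> {-1<..<1}"
    then have "\<bar>t\<bar> < 1" by auto
    then show "(LINT x|lebesgue. \<phi> x) = (LINT x|lebesgue. W x * \<phi> (x + t *\<^sub>R e))"
      by (simp add: 1 integral_lebesgue_translate[OF m])
  qed auto
  ultimately show ?thesis by (rule DERIV_unique)
qed

lemma integral_lebesgue_on_eq:
  fixes f :: "real^'n \<Rightarrow> real"
  assumes "D \<in> sets lebesgue" "\<And>x. x \<notin> D \<Longrightarrow> f x = 0"
  shows "(LINT x|lebesgue_on D. f x) = (LINT x|lebesgue. f x)"
proof -
  have "(LINT x|lebesgue_on D. f x) = (LINT x|lebesgue. indicator D x *\<^sub>R f x)"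
    using assms(1) by (intro integral_restrict_space) auto
  also have "(\<lambda>x. indicator D x *\<^sub>R f x) = f" by (rule ext) (use assms(2) in \<open>auto simp: indicator_def\<close>)
  finally show ?thesis by simp
qed

lemma integral_dirderiv_test_function:
  assumes "test_function D \<phi>" "D \<in> sets lebesgue"
  shows "(LINT x|lebesgue_on D. dirderiv e \<phi> x) = 0"
proof -
  have "(LINT x|lebesgue_on D. dirderiv e \<phi> x) = (LINT x|lebesgue. dirderiv e \<phi> x)"
    using assms dirderiv_outside_support[of _ \<phi> e]
    by (intro integral_lebesgue_on_eq) (auto simp: test_function_def)
  also have "\<dots> = 0"
    using assms(1) by (intro integral_dirderiv_compact_support) (auto simp: test_function_def smooth_def)
  finally show ?thesis .
qed

lemma test_function_mult:
  assumes "test_function D \<phi>" "smooth v"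
  shows "test_function D (\<lambda>x. \<phi> x * v x)"
proof -
  have sub: "closure {x. \<phi> x * v x \<noteq> 0} \<subseteq> closure {x. \<phi> x \<noteq> 0}"
    by (intro closure_mono) auto
  have "compact (closure {x. \<phi> x \<noteq> 0} \<inter> closure {x. \<phi> x * v x \<noteq> 0})"
    using assms(1) by (intro compact_Int_closed) (auto simp: test_function_def)
  then have "compact (closure {x. \<phi> x * v x \<noteq> 0})"
    using sub by (simp add: Int_absorb1)
  moreover have "closure {x. \<phi> x * v x \<noteq> 0} \<subseteq> D"
    using sub assms(1) by (auto simp: test_function_def)
  moreover have "smooth (\<lambda>x. \<phi> x * v x)"
    by (rule smooth_mult[OF smooth_test_function[OF assms(1)] assms(2)])
  ultimately show ?thesis by (simp add: test_function_def smooth_def)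
qed

lemma integrable_lebesgue_on_bounded:
  fixes f :: "real^'n \<Rightarrow> real"
  assumes "f \<in> borel_measurable (lebesgue_on D)" "D \<in> lmeasurable" "\<And>x. x \<in> D \<Longrightarrow> \<bar>f x\<bar> \<le> C"
  shows "integrable (lebesgue_on D) f"
proof -
  interpret finite_measure "lebesgue_on D" using assms(2) by (rule finite_measure_lebesgue_on)
  show ?thesis using assms by (intro integrable_const_bound[where B = C]) auto
qed

lemma integrable_lebesgue_on_continuous:
  fixes f :: "real^'n \<Rightarrow> real"
  assumes "continuous_on K f" "compact K" "D \<subseteq> K" "D \<in> lmeasurable"
  shows "integrable (lebesgue_on D) f"
proof -
  have "compact (f ` K)" using assms by (intro compact_continuous_image)
  then obtain C where "\<And>y. y \<in> f ` K \<Longrightarrow> norm y \<le> C"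
    using compact_imp_bounded bounded_iff by metis
  then have "\<bar>f x\<bar> \<le> C" if "x \<in> D" for x using that assms(3) by fastforce
  moreover have "f \<in> borel_measurable (lebesgue_on D)"
    using assms by (intro continuous_imp_measurable_on_sets_lebesgue) (auto intro: continuous_on_subset)
  ultimately show ?thesis using assms(4) integrable_lebesgue_on_bounded by blast
qed

lemma integrable_lebesgue_on_smooth:
  assumes "smooth f" "bounded D" "D \<in> sets lebesgue"
  shows "integrable (lebesgue_on D) f"
proof (rule integrable_lebesgue_on_continuous[OF smooth_continuous[OF assms(1)]])
  show "compact (closure D)" "D \<subseteq> closure D" using assms(2) closure_subset by auto
  show "D \<in> lmeasurable" using assms by (simp add: bounded_set_imp_lmeasurable)
qed

definition gradient :: "(real^'n::finite \<Rightarrow> real) \<Rightarrow> real^'n \<Rightarrow> real^'n" where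
  "gradient v x = (\<chi> i. partial i v x)"

lemma inner_gradient: "smooth v \<Longrightarrow> e \<bullet> gradient v x = dirderiv e v x"
  by (simp add: dirderiv_eq_sum_partial smooth_differentiable gradient_def inner_vec_def)

text \<open>
  Smooth functions are admissible in the weak formulation of the eigenvalue problem, with their
  classical gradient: apply the vanishing of \<open>\<integral> \<partial>\<^sub>i\<psi>\<close> to the test function \<open>\<psi> = \<phi> v\<close>.
\<close>

lemma H1_gradient_smooth:
  assumes v: "smooth v" and D: "bounded D" "D \<in> sets lebesgue"
  shows "H1_gradient D v (gradient v)"
  unfolding H1_gradient_def
proof (intro conjI)
  show "L2_on D v" unfolding L2_on_def
    using integrable_lebesgue_on_smooth[OF v D] integrable_lebesgue_on_smooth[OF smooth_mult[OF v v] D]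
    by (simp add: power2_eq_square)
  have n: "(norm (gradient v x))\<^sup>2 = (\<Sum>i\<in>UNIV. partial i v x * partial i v x)" for x
    by (simp add: power2_norm_eq_inner inner_vec_def gradient_def)
  have "gradient v \<in> borel_measurable (lebesgue_on D)"
    unfolding gradient_def using D(2)
    by (intro continuous_imp_measurable_on_sets_lebesgue continuous_on_vec_lambda smooth_continuous smooth_partial v)
  then show "L2_on D (gradient v)" unfolding L2_on_def n
    using integrable_lebesgue_on_smooth[OF smooth_sum[of UNIV "\<lambda>i x. partial i v x * partial i v x"] D]
    by (simp add: smooth_mult smooth_partial v)
  show "weak_gradient D v (gradient v)" unfolding weak_gradient_def
  proof (intro allI impI)
    fix \<phi> i assume \<phi>: "test_function D \<phi>"
    have "0 = (LINT x|lebesgue_on D. partial i (\<lambda>x. \<phi> x * v x) x)"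
      using integral_dirderiv_test_function[OF test_function_mult[OF \<phi> v] D(2)] by (simp add: partial_eq_dirderiv)
    also have "\<dots> = (LINT x|lebesgue_on D. v x * partial i \<phi> x + partial i v x * \<phi> x)"
      by (simp add: partial_eq_dirderiv dirderiv_mult v smooth_test_function[OF \<phi>] mult.commute)
    also have "\<dots> = (LINT x|lebesgue_on D. v x * partial i \<phi> x) + (LINT x|lebesgue_on D. partial i v x * \<phi> x)"
      by (intro Bochner_Integration.integral_add integrable_lebesgue_on_smooth smooth_mult smooth_partial v D smooth_test_function[OF \<phi>])
    finally show "(LINT x|lebesgue_on D. v x * partial i \<phi> x) = - (LINT x|lebesgue_on D. gradient v x $ i * \<phi> x)"
      by (simp add: gradient_def)
  qed
qed

section \<open>Functions with vanishing weak gradient\<close>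

lemma AE_lebesgue_on_open_witness:
  fixes U :: "(real^'n) set"
  assumes "AE x in lebesgue_on D. P x" "D \<in> sets lebesgue" "open U" "U \<noteq> {}" "U \<subseteq> D"
  obtains x where "x \<in> U" "P x"
proof -
  have "AE x in lebesgue. x \<in> D \<longrightarrow> P x"
    using assms(1,2) by (simp add: AE_restrict_space_iff)
  then obtain N where N: "N \<in> null_sets lebesgue" "{x. \<not> (x \<in> D \<longrightarrow> P x)} \<subseteq> N"
    unfolding eventually_ae_filter by auto
  have "\<not> U \<subseteq> N"
    using open_not_negligible[OF assms(3,4)] N(1) negligible_subset negligible_iff_null_sets by blast
  then show ?thesis using N(2) assms(5) that by blast
qed

lemma integral_lebesgue_on_pos:
  fixes f :: "real^'n \<Rightarrow> real"
  assumes "integrable (lebesgue_on D) f" "D \<in> sets lebesgue" "\<And>x. x \<in> D \<Longrightarrow> 0 \<le> f x"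
    and "open U" "U \<noteq> {}" "U \<subseteq> D" "\<And>x. x \<in> U \<Longrightarrow> 0 < f x"
  shows "0 < (LINT x|lebesgue_on D. f x)"
proof -
  have nn: "AE x in lebesgue_on D. 0 \<le> f x" using assms(3) by (intro AE_I2) auto
  have "(LINT x|lebesgue_on D. f x) \<noteq> 0"
  proof
    assume "(LINT x|lebesgue_on D. f x) = 0"
    then have "AE x in lebesgue_on D. f x = 0"
      using integral_nonneg_eq_0_iff_AE[OF assms(1) nn] by simp
    then obtain x where "x \<in> U" "f x = 0"
      by (rule AE_lebesgue_on_open_witness[OF _ assms(2,4,5,6)])
    with assms(7)[of x] show False by simp
  qed
  moreover have "0 \<le> (LINT x|lebesgue_on D. f x)" using nn by (rule integral_nonneg_AE)
  ultimately show ?thesis by simp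
qed

lemma smooth_norm_sq: "smooth (\<lambda>x::real^'a::finite. (x - y) \<bullet> (x - y))"
proof -
  have "(\<lambda>x. (x - y) \<bullet> (x - y)) = (\<lambda>x. (\<Sum>i\<in>UNIV. (x \<bullet> axis i 1) * (x \<bullet> axis i 1)) + ((-2) * (x \<bullet> y) + y \<bullet> y))"
  proof
    fix x :: "real^'a"
    have "x \<bullet> x = (\<Sum>i\<in>UNIV. (x \<bullet> axis i 1) * (x \<bullet> axis i 1))" by (simp add: inner_axis) (simp add: inner_vec_def)
    then show "(x - y) \<bullet> (x - y) = (\<Sum>i\<in>UNIV. (x \<bullet> axis i 1) * (x \<bullet> axis i 1)) + ((-2) * (x \<bullet> y) + y \<bullet> y)"
      by (simp add: inner_diff_left inner_diff_right inner_commute[of y x])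
  qed
  then show ?thesis
    by (simp only:) (intro smooth_add smooth_sum smooth_mult smooth_inner smooth_const)
qed

text \<open>
  The radial bump with support \<open>cball y \<rho>\<close>, used both as a test function and, centred at a boundary
  point, as a local minorant.
\<close>

definition bump :: "real \<Rightarrow> real^'n \<Rightarrow> real^'n \<Rightarrow> real" where
  "bump \<rho> y x = flat 1 (\<rho>\<^sup>2 - (x - y) \<bullet> (x - y))"

lemma smooth_bump: "smooth (bump \<rho> y)"
proof -
  have "bump \<rho> y = (\<lambda>x. flat 1 (\<rho>\<^sup>2 + (-1) * ((x - y) \<bullet> (x - y))))" by (auto simp: bump_def)
  then show ?thesis by (simp only:) (intro smooth_flat smooth_add smooth_mult smooth_const smooth_norm_sq)
qed

lemma in_ball_iff_inner: "0 < \<rho> \<Longrightarrow> x \<in> ball y \<rho> \<longleftrightarrow> 0 < \<rho>\<^sup>2 - (x - y) \<bullet> (x - y)"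
  by (simp add: dist_norm norm_minus_commute norm_lt_square)

lemma bump_nonneg: "0 \<le> bump \<rho> y x"
  by (simp add: bump_def flat_def)

lemma bump_pos_iff: "0 < \<rho> \<Longrightarrow> 0 < bump \<rho> y x \<longleftrightarrow> x \<in> ball y \<rho>"
  unfolding in_ball_iff_inner by (simp add: bump_def flat_def)

lemma bump_eq_0_iff: "0 < \<rho> \<Longrightarrow> bump \<rho> y x = 0 \<longleftrightarrow> x \<notin> ball y \<rho>"
  using bump_pos_iff[of \<rho> y x] bump_nonneg[of \<rho> y x] by linarith

lemma test_function_bump:
  assumes "0 < \<rho>" "cball y \<rho> \<subseteq> D"
  shows "test_function D (bump \<rho> y)"
proof -
  have "{x. bump \<rho> y x \<noteq> 0} = ball y \<rho>" using assms(1) by (auto simp: bump_eq_0_iff)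
  then show ?thesis using assms smooth_bump[of \<rho> y]
    by (simp add: test_function_def smooth_def)
qed

lemma dirderiv_bump:
  "dirderiv e (bump \<rho> y) x = flat [:0, 0, 1:] (\<rho>\<^sup>2 - (x - y) \<bullet> (x - y)) * (- 2 * ((x - y) \<bullet> e))"
proof (rule dirderiv_eq)
  have 1: "((\<lambda>x. \<rho>\<^sup>2 - (x - y) \<bullet> (x - y)) has_derivative (\<lambda>e. - 2 * ((x - y) \<bullet> e))) (at x)"
    by (auto intro!: derivative_eq_intros simp: inner_commute)
  show "(bump \<rho> y has_derivative (\<lambda>e. flat [:0, 0, 1:] (\<rho>\<^sup>2 - (x - y) \<bullet> (x - y)) * (- 2 * ((x - y) \<bullet> e)))) (at x)"
    unfolding bump_def
    using has_derivative_compose[OF 1 flat_deriv[of 1, unfolded has_field_derivative_def]] by simp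
qed

lemma smooth_measurable: "smooth f \<Longrightarrow> D \<in> sets lebesgue \<Longrightarrow> f \<in> borel_measurable (lebesgue_on D)"
  by (intro continuous_imp_measurable_on_sets_lebesgue smooth_continuous)

lemma integrable_mult_smooth:
  assumes "integrable (lebesgue_on D) f" "smooth h" "bounded D" "D \<in> sets lebesgue"
  shows "integrable (lebesgue_on D) (\<lambda>x. f x * h x)"
proof -
  have "compact (h ` closure D)"
    using assms by (intro compact_continuous_image smooth_continuous) (auto simp: compact_closure)
  then obtain C where "\<And>y. y \<in> h ` closure D \<Longrightarrow> norm y \<le> C"
    using compact_imp_bounded bounded_iff by metis
  then have "\<bar>h x\<bar> \<le> C" if "x \<in> D" for x using that closure_subset[of D] by fastforce
  then show ?thesis
    using assms by (intro integrable_mult_bounded[where C = C] smooth_measurable) auto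
qed

lemma weak_gradient_dirderiv:
  fixes g :: "real^'n::finite \<Rightarrow> real^'n"
  assumes wg: "weak_gradient D W g" and D: "bounded D" "D \<in> sets lebesgue"
    and W: "integrable (lebesgue_on D) W" and g: "\<And>i. integrable (lebesgue_on D) (\<lambda>x. g x $ i)"
    and \<phi>: "test_function D \<phi>"
  shows "(LINT x|lebesgue_on D. W x * dirderiv e \<phi> x) = - (LINT x|lebesgue_on D. (g x \<bullet> e) * \<phi> x)"
proof -
  have int: "integrable (lebesgue_on D) (\<lambda>x. W x * partial i \<phi> x)" for i
    by (rule integrable_mult_smooth[OF W smooth_partial[OF smooth_test_function[OF \<phi>]] D])
  have int': "integrable (lebesgue_on D) (\<lambda>x. g x $ i * \<phi> x)" for i
    by (rule integrable_mult_smooth[OF g smooth_test_function[OF \<phi>] D])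
  have "(LINT x|lebesgue_on D. W x * dirderiv e \<phi> x) = (LINT x|lebesgue_on D. (\<Sum>i\<in>UNIV. e $ i * (W x * partial i \<phi> x)))"
    by (simp add: dirderiv_eq_sum_partial smooth_differentiable[OF smooth_test_function[OF \<phi>]] sum_distrib_left mult.left_commute)
  also have "\<dots> = (\<Sum>i\<in>UNIV. e $ i * (LINT x|lebesgue_on D. W x * partial i \<phi> x))"
    by (simp add: int)
  also have "\<dots> = - (\<Sum>i\<in>UNIV. e $ i * (LINT x|lebesgue_on D. g x $ i * \<phi> x))"
    using wg \<phi> by (simp add: weak_gradient_def sum_negf)
  also have "\<dots> = - (LINT x|lebesgue_on D. (\<Sum>i\<in>UNIV. e $ i * (g x $ i * \<phi> x)))"
    by (simp add: int')
  also have "\<dots> = - (LINT x|lebesgue_on D. (g x \<bullet> e) * \<phi> x)"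
    by (simp add: inner_vec_def sum_distrib_left sum_distrib_right mult_ac)
  finally show ?thesis .
qed

lemma segment_thickening:
  fixes D :: "'a::euclidean_space set"
  assumes "open D" "convex D" "p \<in> D" "q \<in> D"
  obtains \<rho>0 where "0 < \<rho>0" "\<And>y. y \<in> closed_segment p q \<Longrightarrow> cball y \<rho>0 \<subseteq> D"
proof -
  have "compact (closed_segment p q)" "closed_segment p q \<subseteq> D"
    using assms by (auto simp: closed_segment_subset)
  then obtain e where "0 < e" "{x. infdist x (closed_segment p q) \<le> e} \<subseteq> D"
    using compact_in_open_separated[of "closed_segment p q" D] assms(1) by auto
  moreover have "infdist x (closed_segment p q) \<le> e" if "y \<in> closed_segment p q" "x \<in> cball y e" for x y
    using infdist_le[OF that(1), of x] that(2) by (auto simp: dist_commute)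
  ultimately show ?thesis using that[of e] by blast
qed

text \<open>
  The mean of \<open>w - c\<close> against a bump does not change when the bump slides along the segment from \<open>p\<close> to
  \<open>q\<close>, because its derivative is the integral against a directional derivative of a test function.
  If \<open>w q < c < w p\<close>, a narrow bump gives a positive mean at \<open>p\<close> and a negative one at \<open>q\<close>.
\<close>

lemma weak_gradient_zero_imp_le:
  fixes w :: "real^'n::finite \<Rightarrow> real"
  assumes D: "open D" "convex D" "bounded D" and cont: "continuous_on D w"
    and w: "integrable (lebesgue_on D) w" and wg: "weak_gradient D w (\<lambda>_. 0)"
    and pq: "p \<in> D" "q \<in> D"
  shows "w p \<le> w q"
proof (rule ccontr)
  assume "\<not> w p \<le> w q"
  define c where "c = (w p + w q) / 2"
  have c: "c < w p" "w q < c" using \<open>\<not> w p \<le> w q\<close> by (auto simp: c_def)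
  have Ds: "D \<in> sets lebesgue" using D(1) by auto
  obtain \<rho>0 where \<rho>0: "0 < \<rho>0" "\<And>y. y \<in> closed_segment p q \<Longrightarrow> cball y \<rho>0 \<subseteq> D"
    using segment_thickening[OF D(1,2) pq] by metis
  have isC: "isCont w p" "isCont w q" using cont D(1) pq continuous_on_eq_continuous_at by blast+
  have "\<forall>\<^sub>F x in nhds p. c < w x" "\<forall>\<^sub>F x in nhds q. w x < c"
    using isC c order_tendstoD unfolding isCont_def tendsto_at_iff_tendsto_nhds by blast+
  then obtain \<delta>1 \<delta>2 where \<delta>: "0 < \<delta>1" "\<And>x. dist x p < \<delta>1 \<Longrightarrow> c < w x" "0 < \<delta>2" "\<And>x. dist x q < \<delta>2 \<Longrightarrow> w x < c"
    unfolding eventually_nhds_metric by metis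
  define \<rho> where "\<rho> = min \<rho>0 (min \<delta>1 \<delta>2)"
  have \<rho>: "0 < \<rho>" using \<rho>0 \<delta> by (auto simp: \<rho>_def)
  have sub: "cball y \<rho> \<subseteq> D" if "y \<in> closed_segment p q" for y
    using \<rho>0(2)[OF that] subset_cball[of \<rho> \<rho>0 y] by (auto simp: \<rho>_def)
  \<comment> \<open>Continued by zero, \<open>w - c\<close> can be integrated against translates of one fixed bump.\<close>
  define W where "W = (\<lambda>x. indicator D x *\<^sub>R (w x - c))"
  have Dm: "integrable (lebesgue_on D) (\<lambda>x. (w x - c) * bump \<rho> y x)"
    "(LINT x|lebesgue_on D. (w x - c) * dirderiv e (bump \<rho> y) x) = 0"
    if "y \<in> closed_segment p q" for y e
  proof -
    have t: "test_function D (bump \<rho> y)" by (rule test_function_bump[OF \<rho> sub[OF that]])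
    have i1: "integrable (lebesgue_on D) (bump \<rho> y)"
      "integrable (lebesgue_on D) (dirderiv e (bump \<rho> y))"
      by (intro integrable_lebesgue_on_smooth smooth_dirderiv smooth_bump D(3) Ds)+
    have i2: "integrable (lebesgue_on D) (\<lambda>x. w x * bump \<rho> y x)"
      "integrable (lebesgue_on D) (\<lambda>x. w x * dirderiv e (bump \<rho> y) x)"
      by (intro integrable_mult_smooth w smooth_bump smooth_dirderiv D(3) Ds)+
    show "integrable (lebesgue_on D) (\<lambda>x. (w x - c) * bump \<rho> y x)"
      unfolding left_diff_distrib using i1 i2 by auto
    show "(LINT x|lebesgue_on D. (w x - c) * dirderiv e (bump \<rho> y) x) = 0"
      unfolding left_diff_distrib
      using weak_gradient_dirderiv[OF wg D(3) Ds w _ t, of e] integral_dirderiv_test_function[OF t Ds, of e] i1 i2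
      by simp
  qed
  have Wint: "(LINT x|lebesgue. W x * f x) = (LINT x|lebesgue_on D. (w x - c) * f x)" for f :: "real^'n \<Rightarrow> real"
  proof -
    have "(LINT x|lebesgue_on D. (w x - c) * f x) = (LINT x|lebesgue. indicator D x *\<^sub>R ((w x - c) * f x))"
      using Ds by (intro integral_restrict_space) auto
    then show ?thesis by (simp add: W_def mult.assoc)
  qed
  have seg: "p + t *\<^sub>R (q - p) \<in> closed_segment p q" if "t \<in> {0..1}" for t
    using that by (auto simp: in_segment algebra_simps intro!: exI[of _ t])
  define G where "G t = (LINT x|lebesgue. W x * bump \<rho> p (x + t *\<^sub>R (p - q)))" for t
  have shift: "bump \<rho> p (x + t *\<^sub>R (p - q)) = bump \<rho> (p + t *\<^sub>R (q - p)) x" for x t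
    by (simp add: bump_def algebra_simps)
  have shift': "dirderiv (p - q) (bump \<rho> p) (x + t *\<^sub>R (p - q)) = dirderiv (p - q) (bump \<rho> (p + t *\<^sub>R (q - p))) x" for x t
  proof -
    have "x + t *\<^sub>R (p - q) - p = x - (p + t *\<^sub>R (q - p))" by (simp add: algebra_simps)
    then show ?thesis by (simp only: dirderiv_bump)
  qed
  have "integrable (lebesgue_on D) (\<lambda>x. w x - c)"
    using w integrable_lebesgue_on_smooth[OF smooth_const D(3) Ds, of c] by auto
  then have intW: "integrable lebesgue W"
    unfolding W_def using Ds by (subst (asm) integrable_restrict_space) auto
  have dG: "(G has_real_derivative 0) (at t)" if "t \<in> {0..1}" for t
  proof -
    have "compact (closure {x. bump \<rho> p x \<noteq> 0})"
      using test_function_bump[OF \<rho>, of p UNIV] by (simp add: test_function_def)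
    from DERIV_integral_translate[OF intW smooth_bump this, of "p - q" t]
    show ?thesis unfolding G_def[abs_def] shift' Wint by (simp add: Dm(2)[OF seg[OF that]])
  qed
  have "G 1 = G 0"
    by (rule DERIV_isconst_end) (use dG in \<open>auto intro!: DERIV_continuous_on[where D = "\<lambda>_. 0"] DERIV_subset[OF dG]\<close>)
  have G: "G t = (LINT x|lebesgue_on D. (w x - c) * bump \<rho> (p + t *\<^sub>R (q - p)) x)" for t
    unfolding G_def shift Wint ..
  have "0 < (LINT x|lebesgue_on D. (w x - c) * bump \<rho> p x)"
  proof (rule integral_lebesgue_on_pos[where U = "ball p \<rho>"])
    show "integrable (lebesgue_on D) (\<lambda>x. (w x - c) * bump \<rho> p x)" by (rule Dm(1)) simp
    show "0 < (w x - c) * bump \<rho> p x" if "x \<in> ball p \<rho>" for x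
      using that bump_pos_iff[OF \<rho>, of p x] \<delta>(2)[of x] by (simp add: \<rho>_def dist_commute)
    then show "0 \<le> (w x - c) * bump \<rho> p x" for x
      using bump_eq_0_iff[OF \<rho>, of p x] by (cases "x \<in> ball p \<rho>") (auto simp: less_imp_le)
    show "ball p \<rho> \<subseteq> D" using sub[of p] ball_subset_cball[of p \<rho>] by auto
  qed (use \<rho> Ds in auto)
  moreover have "0 < (LINT x|lebesgue_on D. - ((w x - c) * bump \<rho> q x))"
  proof (rule integral_lebesgue_on_pos[where U = "ball q \<rho>"])
    show "integrable (lebesgue_on D) (\<lambda>x. - ((w x - c) * bump \<rho> q x))" using Dm(1)[of q] by simp
    show "0 < - ((w x - c) * bump \<rho> q x)" if "x \<in> ball q \<rho>" for x
      using that bump_pos_iff[OF \<rho>, of q x] \<delta>(4)[of x] by (simp add: \<rho>_def dist_commute mult_neg_pos)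
    then show "0 \<le> - ((w x - c) * bump \<rho> q x)" for x
      using bump_eq_0_iff[OF \<rho>, of q x] by (cases "x \<in> ball q \<rho>") (auto simp: less_imp_le)
    show "ball q \<rho> \<subseteq> D" using sub[of q] ball_subset_cball[of q \<rho>] by auto
  qed (use \<rho> Ds in auto)
  ultimately show False using \<open>G 1 = G 0\<close> by (simp add: G)
qed

lemma weak_gradient_zero_imp_constant:
  fixes w :: "real^'n::finite \<Rightarrow> real"
  assumes "open D" "convex D" "bounded D" "continuous_on D w"
    and "integrable (lebesgue_on D) w" "weak_gradient D w (\<lambda>_. 0)"
    and "p \<in> D" "q \<in> D"
  shows "w p = w q"
  using weak_gradient_zero_imp_le assms by (metis order_antisym)

section \<open>The triangle and its boundary layers\<close>

lemma weak_gradient_const: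
  assumes "D \<in> sets lebesgue"
  shows "weak_gradient D (\<lambda>_. c) (\<lambda>_. 0)"
  unfolding weak_gradient_def partial_eq_dirderiv
  using integral_dirderiv_test_function[OF _ assms] by simp

lemma third_index:
  fixes i j :: 3
  assumes "i \<noteq> j"
  obtains l where "l \<noteq> i" "l \<noteq> j" "\<And>k. k = i \<or> k = j \<or> k = l"
proof -
  have "card (UNIV - {i, j}) = 1"
    using assms by (subst card_Diff_subset) auto
  then obtain l where "UNIV - {i, j} = {l}" by (auto simp: card_1_singleton_iff)
  then show ?thesis by (intro that[of l]) auto
qed

lemma cos_eq_1_shift:
  assumes "cos a = 1" "0 < \<delta>" "\<delta> < 2 * pi"
  shows "cos (a - \<delta>) \<noteq> (1::real)"
proof
  assume *: "cos (a - \<delta>) = 1"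
  have "sin a = 0" using assms(1) sin_cos_squared_add[of a] by simp
  then have "cos \<delta> = 1" using * assms(1) by (simp add: cos_diff)
  then obtain n :: int where "\<delta> = n * 2 * pi" by (auto simp: cos_one_2pi_int)
  then have "0 < real_of_int n" "real_of_int n < 1" using assms(2,3) by (auto simp: zero_less_mult_iff)
  then have "0 < n" "n < 1" by simp_all
  then show False by simp
qed

text \<open>
  An equilateral triangle with incentre \<open>z\<close>, inradius \<open>r\<close> and inward unit normals \<open>m i\<close> of its three
  sides. The value \<open>- 1/2\<close> is the cosine of the angle \<open>2 \<pi> / 3\<close> between two normals.
\<close>

locale equilateral =
  fixes m :: "3 \<Rightarrow> real^2" and z :: "real^2" and r :: real
  assumes inner_m: "m i \<bullet> m j = (if i = j then 1 else - 1 / 2)"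
    and r_pos: "0 < r"
    and bounded: "bounded {x. \<forall>i. 0 \<le> m i \<bullet> (x - z) + r}"
begin

definition d :: "3 \<Rightarrow> real^2 \<Rightarrow> real" where "d i x = m i \<bullet> (x - z) + r"

definition T :: "(real^2) set" where "T = {x. \<forall>i. 0 \<le> d i x}"
definition D :: "(real^2) set" where "D = {x. \<forall>i. 0 < d i x}"

lemma sum_m: "(\<Sum>i\<in>UNIV. m i) = 0"
proof -
  have "(\<Sum>i\<in>UNIV. m i) \<bullet> (\<Sum>i\<in>UNIV. m i) = 0"
    by (simp add: sum_3 inner_add_left inner_add_right inner_m)
  then show ?thesis by simp
qed

text \<open>
  The Gram matrix of the normals is \<open>3/2\<close> times the identity minus \<open>1/2\<close> times the all-ones matrix.
\<close>

lemma sum_inner_m: "(\<Sum>i\<in>UNIV. (m j \<bullet> m i) * a i) = 3 / 2 * a j - (\<Sum>i\<in>UNIV. a i) / 2"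
proof -
  have "(\<Sum>i\<in>UNIV. (m j \<bullet> m i) * a i) = (\<Sum>i\<in>UNIV. (if i = j then 3 / 2 * a i else 0) - a i / 2)"
    by (rule sum.cong) (auto simp: inner_m)
  then show ?thesis by (simp add: sum_subtractf sum_divide_distrib)
qed

lemma sum_d: "(\<Sum>i\<in>UNIV. d i x) = 3 * r"
proof -
  have "(\<Sum>i\<in>UNIV. d i x) = (\<Sum>i\<in>UNIV. m i) \<bullet> (x - z) + 3 * r"
    by (simp add: d_def sum_3 inner_add_left)
  then show ?thesis by (simp add: sum_m)
qed

lemma d_center: "d i z = r"
  by (simp add: d_def)

lemma d_add: "d i (x + e) = d i x + m i \<bullet> e"
  by (simp add: d_def inner_diff_right inner_add_right)

lemma smooth_d: "smooth (d i)"
proof -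
  have "d i = (\<lambda>x. x \<bullet> m i + (r - m i \<bullet> z))" by (auto simp: d_def inner_diff_right inner_commute)
  then show ?thesis by (simp only:) (intro smooth_add smooth_inner smooth_const)
qed

lemma d_has_derivative: "(d i has_derivative (\<lambda>e. m i \<bullet> e)) (at x)"
  unfolding d_def[abs_def] by (auto intro!: derivative_eq_intros)

lemma D_subset_T: "D \<subseteq> T"
  by (auto simp: D_def T_def less_imp_le)

lemma d_pos: "x \<in> D \<Longrightarrow> 0 < d i x"
  by (simp add: D_def)

lemma d_nonzero: "x \<in> D \<Longrightarrow> d i x \<noteq> 0"
  using d_pos[of x i] by simp

lemma T_eq_Inter: "T = (\<Inter>i. {x. m i \<bullet> x \<ge> m i \<bullet> z - r})"
  by (auto simp: T_def d_def inner_diff_right algebra_simps)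

lemma convex_T: "convex T"
  unfolding T_eq_Inter by (intro convex_INT convex_halfspace_ge)

lemma compact_T: "compact T"
  using bounded unfolding T_def d_def compact_eq_bounded_closed
  by (auto intro!: closed_Collect_all closed_Collect_le continuous_intros)

lemma interior_T: "interior T = D"
proof -
  have m0: "m i \<noteq> 0" for i using inner_m[of i i] by auto
  have "T = {x. m 1 \<bullet> x \<ge> m 1 \<bullet> z - r} \<inter> {x. m 2 \<bullet> x \<ge> m 2 \<bullet> z - r} \<inter> {x. m 3 \<bullet> x \<ge> m 3 \<bullet> z - r}"
    by (auto simp: T_def d_def inner_diff_right forall_3 algebra_simps)
  then show ?thesis
    by (simp add: m0) (auto simp: D_def d_def inner_diff_right forall_3 algebra_simps)
qed

lemma closure_D: "closure D = T"
proof -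
  have "z \<in> interior T" unfolding interior_T by (simp add: D_def d_center r_pos)
  then have "closure (interior T) = closure T"
    by (intro convex_closure_interior convex_T) auto
  then show ?thesis using compact_T by (simp add: interior_T compact_imp_closed)
qed

lemma D_facts: "open D" "convex D" "bounded D" "D \<in> sets lebesgue" "D \<in> lmeasurable" "D \<noteq> {}"
proof -
  show "open D" "convex D" using open_interior[of T] convex_interior[OF convex_T] by (simp_all add: interior_T)
  then show "bounded D" "D \<in> sets lebesgue"
    using bounded_subset[OF compact_imp_bounded[OF compact_T] D_subset_T] by auto
  then show "D \<in> lmeasurable" by (simp add: bounded_set_imp_lmeasurable)
  show "D \<noteq> {}" using d_center r_pos by (auto simp: D_def intro!: exI[of _ z])
qed

lemma integrable_T: "continuous_on T (f :: real^2 \<Rightarrow> real) \<Longrightarrow> integrable (lebesgue_on D) f"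
  by (rule integrable_lebesgue_on_continuous[OF _ compact_T D_subset_T D_facts(5)])

definition scaled :: "nat \<Rightarrow> 3 \<Rightarrow> real^2 \<Rightarrow> real" where
  "scaled n i x = real (Suc n) * d i x - 1"

text \<open>
  As \<open>n\<close> grows, \<open>flat 1 (scaled n i x) = exp (- 1 / scaled n i x)\<close> tends to \<open>1\<close> at every interior
  point; the shift by \<open>- 1\<close> in \<open>scaled\<close> makes the cutoff vanish near the boundary, so that it is a
  test function.
\<close>

definition cutoff :: "nat \<Rightarrow> real^2 \<Rightarrow> real" where
  "cutoff n x = (\<Prod>i\<in>UNIV. flat 1 (scaled n i x))"

text \<open>
  The part of the gradient of the cutoff that comes from its \<open>i\<close>-th factor, see \<open>dirderiv_cutoff\<close>. For
  large \<open>n\<close> it plays the role of the arc length measure on the \<open>i\<close>-th side.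
\<close>

definition layer :: "nat \<Rightarrow> 3 \<Rightarrow> real^2 \<Rightarrow> real" where
  "layer n i x = real (Suc n) * flat [:0, 0, 1:] (scaled n i x) * (\<Prod>j\<in>UNIV - {i}. flat 1 (scaled n j x))"

lemma smooth_scaled: "smooth (scaled n i)"
proof -
  have "scaled n i = (\<lambda>x. real (Suc n) * d i x + (-1))" by (auto simp: scaled_def)
  then show ?thesis by (simp only:) (intro smooth_add smooth_mult smooth_const smooth_d)
qed

lemma smooth_cutoff: "smooth (cutoff n)"
  unfolding cutoff_def[abs_def] by (intro smooth_prod smooth_flat smooth_scaled)

lemma smooth_layer: "smooth (layer n i)"
  unfolding layer_def[abs_def] by (intro smooth_mult smooth_const smooth_prod smooth_flat smooth_scaled)

lemma dirderiv_cutoff: "dirderiv e (cutoff n) x = (\<Sum>i\<in>UNIV. (m i \<bullet> e) * layer n i x)"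
proof -
  have scaled: "(scaled n i has_derivative (\<lambda>e. real (Suc n) * (m i \<bullet> e))) (at x)" for i
    unfolding scaled_def[abs_def] by (auto intro!: derivative_eq_intros d_has_derivative simp del: of_nat_Suc)
  have f: "((\<lambda>x. flat 1 (scaled n i x)) has_derivative
      (\<lambda>e. flat [:0, 0, 1:] (scaled n i x) * (real (Suc n) * (m i \<bullet> e)))) (at x)" for i
    using has_derivative_compose[OF scaled flat_deriv[of 1, unfolded has_field_derivative_def]] by simp
  have "(cutoff n has_derivative (\<lambda>e. \<Sum>i\<in>UNIV. flat [:0, 0, 1:] (scaled n i x) * (real (Suc n) * (m i \<bullet> e)) *
      (\<Prod>j\<in>UNIV - {i}. flat 1 (scaled n j x)))) (at x)"
    unfolding cutoff_def[abs_def] by (rule has_derivative_prod[OF f])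
  from dirderiv_eq[OF this, of e] show ?thesis
    by (simp add: layer_def mult_ac del: of_nat_Suc)
qed

lemma layer_nonneg: "0 \<le> layer n i x"
  unfolding layer_def by (intro mult_nonneg_nonneg prod_nonneg flat_nonneg flat_1_bounds ballI) auto

lemma layer_le: "layer n i x \<le> real (Suc n) * flat [:0, 0, 1:] (scaled n i x)"
  unfolding layer_def by (intro mult_left_le prod_le_1 mult_nonneg_nonneg conjI flat_nonneg flat_1_bounds) auto

lemma d_layer_le: assumes "x \<in> D" shows "d i x * layer n i x \<le> 2"
proof -
  have "d i x * layer n i x \<le> d i x * (real (Suc n) * flat [:0, 0, 1:] (scaled n i x))"
    using assms by (intro mult_left_mono layer_le) (auto simp: D_def less_imp_le)
  also have "\<dots> = (scaled n i x + 1) * flat [:0, 0, 1:] (scaled n i x)" by (simp add: scaled_def)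
  also have "\<dots> \<le> 2" by (rule mult_flat_deriv_le)
  finally show ?thesis .
qed

lemma tendsto_scaled: "(\<lambda>n. scaled n i x / real (Suc n)) \<longlonglongrightarrow> d i x"
proof -
  have "(\<lambda>n. d i x - inverse (real (Suc n))) \<longlonglongrightarrow> d i x - 0"
    by (intro tendsto_intros LIMSEQ_inverse_real_of_nat)
  moreover have "scaled n i x / real (Suc n) = d i x - inverse (real (Suc n))" for n
    by (simp add: scaled_def diff_divide_distrib inverse_eq_divide)
  ultimately show ?thesis by simp
qed

lemma eventually_scaled_pos: "x \<in> D \<Longrightarrow> \<forall>\<^sub>F n in sequentially. 0 < scaled n i x"
  using order_tendstoD(1)[OF tendsto_scaled, of 0 i x]
  by (auto simp: D_def zero_less_divide_iff elim!: eventually_mono)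

lemma cutoff_bounds: "0 \<le> cutoff n x" "cutoff n x \<le> 1"
  by (auto simp: cutoff_def intro!: prod_nonneg prod_le_1 flat_1_bounds)

lemma cutoff_tendsto: assumes "x \<in> D" shows "(\<lambda>n. cutoff n x) \<longlonglongrightarrow> 1"
proof -
  have "(\<lambda>n. flat 1 (scaled n i x)) \<longlonglongrightarrow> 1" for i
  proof -
    have "(\<lambda>n. exp (- (inverse (real (Suc n)) / (scaled n i x / real (Suc n))))) \<longlonglongrightarrow> exp (- (0 / d i x))"
      using assms by (intro tendsto_intros LIMSEQ_inverse_real_of_nat tendsto_scaled) (auto simp: d_nonzero)
    then have "(\<lambda>n. exp (- (inverse (real (Suc n)) / (scaled n i x / real (Suc n))))) \<longlonglongrightarrow> 1" by simp
    then show ?thesis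
      by (rule Lim_transform_eventually)
         (use eventually_scaled_pos[OF assms, of i] in \<open>auto simp: flat_def field_simps elim!: eventually_mono\<close>)
  qed
  then have "(\<lambda>n. cutoff n x) \<longlonglongrightarrow> (\<Prod>i\<in>(UNIV::3 set). 1)"
    unfolding cutoff_def by (intro tendsto_prod)
  then show ?thesis by simp
qed

lemma layer_tendsto: assumes "x \<in> D" shows "(\<lambda>n. layer n i x) \<longlonglongrightarrow> 0"
proof (rule tendsto_sandwich[where f = "\<lambda>_. 0"])
  have "(\<lambda>n. inverse (real (Suc n)) / (scaled n i x / real (Suc n))\<^sup>2) \<longlonglongrightarrow> 0 / (d i x)\<^sup>2"
    using assms by (intro tendsto_intros LIMSEQ_inverse_real_of_nat tendsto_scaled) (auto simp: d_nonzero)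
  then show "(\<lambda>n. inverse (real (Suc n)) / (scaled n i x / real (Suc n))\<^sup>2) \<longlonglongrightarrow> 0" by simp
  show "\<forall>\<^sub>F n in sequentially. layer n i x \<le> inverse (real (Suc n)) / (scaled n i x / real (Suc n))\<^sup>2"
    using eventually_scaled_pos[OF assms, of i]
  proof (rule eventually_mono)
    fix n assume "0 < scaled n i x"
    have "layer n i x \<le> real (Suc n) * flat [:0, 0, 1:] (scaled n i x)" by (rule layer_le)
    also have "\<dots> \<le> real (Suc n) * (1 / (scaled n i x)\<^sup>2)"
      by (intro mult_left_mono flat_deriv_le \<open>0 < scaled n i x\<close>) auto
    also have "\<dots> = inverse (real (Suc n)) / (scaled n i x / real (Suc n))\<^sup>2"
      by (simp add: power2_eq_square field_simps del: of_nat_Suc)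
    finally show "layer n i x \<le> inverse (real (Suc n)) / (scaled n i x / real (Suc n))\<^sup>2" .
  qed
qed (auto simp: layer_nonneg)

lemma test_function_cutoff: "test_function D (cutoff n)"
proof -
  let ?C = "{x. \<forall>i. inverse (real (Suc n)) \<le> d i x}"
  have "{x. cutoff n x \<noteq> 0} \<subseteq> ?C"
  proof
    fix x assume "x \<in> {x. cutoff n x \<noteq> 0}"
    then have "flat 1 (scaled n i x) \<noteq> 0" for i by (auto simp: cutoff_def)
    then have "0 < scaled n i x" for i by (metis flat_def)
    then show "x \<in> ?C" by (auto simp: scaled_def inverse_eq_divide divide_le_eq mult.commute less_imp_le simp del: of_nat_Suc)
  qed
  moreover have "closed ?C"
    by (intro closed_Collect_all closed_Collect_le continuous_intros smooth_continuous smooth_d)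
  ultimately have cl: "closure {x. cutoff n x \<noteq> 0} \<subseteq> ?C" by (simp add: closure_minimal)
  have "?C \<subseteq> D" by (auto simp: D_def intro: less_le_trans[of 0 "inverse (real (Suc n))"])
  with cl have sub: "closure {x. cutoff n x \<noteq> 0} \<subseteq> D" by blast
  then have "compact (closure {x. cutoff n x \<noteq> 0})"
    unfolding compact_closure using D_facts(3) bounded_subset closure_subset by (metis order_trans)
  with sub show ?thesis using smooth_cutoff[of n] by (simp add: test_function_def smooth_def)
qed

definition layer_int :: "nat \<Rightarrow> 3 \<Rightarrow> (real^2 \<Rightarrow> real) \<Rightarrow> real" where
  "layer_int n i H = (LINT x|lebesgue_on D. H x * layer n i x)"

lemma integrable_layer: "integrable (lebesgue_on D) H \<Longrightarrow> integrable (lebesgue_on D) (\<lambda>x. H x * layer n i x)"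
  by (rule integrable_mult_smooth[OF _ smooth_layer D_facts(3,4)])

lemma layer_int_mono:
  assumes "integrable (lebesgue_on D) H" "integrable (lebesgue_on D) H'" "\<And>x. x \<in> D \<Longrightarrow> H x \<le> H' x"
  shows "layer_int n i H \<le> layer_int n i H'"
  unfolding layer_int_def using assms
  by (intro integral_mono integrable_layer mult_right_mono layer_nonneg) auto

lemma layer_int_add:
  assumes "integrable (lebesgue_on D) H" "integrable (lebesgue_on D) H'"
  shows "layer_int n i (\<lambda>x. H x + H' x) = layer_int n i H + layer_int n i H'"
  unfolding layer_int_def using integrable_layer[OF assms(1), of n i] integrable_layer[OF assms(2), of n i] by (simp add: distrib_right)

lemma layer_int_cmult: "layer_int n i (\<lambda>x. c * H x) = c * layer_int n i H"
  unfolding layer_int_def by (simp add: mult.assoc)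

lemma layer_int_sum:
  assumes "\<And>j. j \<in> A \<Longrightarrow> integrable (lebesgue_on D) (H j)"
  shows "layer_int n i (\<lambda>x. \<Sum>j\<in>A. H j x) = (\<Sum>j\<in>A. layer_int n i (H j))"
  unfolding layer_int_def sum_distrib_right using assms by (intro Bochner_Integration.integral_sum integrable_layer)

text \<open>
  The integrands are at most \<open>2\<close> and tend to \<open>0\<close> pointwise.
\<close>

lemma tendsto_layer_int_d: "(\<lambda>n. layer_int n i (d i)) \<longlonglongrightarrow> 0"
proof -
  have "(\<lambda>n. LINT x|lebesgue_on D. d i x * layer n i x) \<longlonglongrightarrow> (LINT x|lebesgue_on D. 0)"
  proof (rule integral_dominated_convergence[where w = "\<lambda>_. 2"])
    show "(\<lambda>x. d i x * layer n i x) \<in> borel_measurable (lebesgue_on D)" for n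
      by (intro smooth_measurable smooth_mult smooth_d smooth_layer D_facts)
    show "integrable (lebesgue_on D) (\<lambda>_. 2 :: real)"
      by (intro integrable_lebesgue_on_smooth smooth_const D_facts)
    show "AE x in lebesgue_on D. (\<lambda>n. d i x * layer n i x) \<longlonglongrightarrow> 0"
      using tendsto_mult[OF tendsto_const layer_tendsto] by (intro AE_I2) fastforce
    show "AE x in lebesgue_on D. norm (d i x * layer n i x) \<le> 2" for n
    proof (intro AE_I2)
      fix x assume "x \<in> space (lebesgue_on D)"
      then have x: "x \<in> D" by simp
      then have "0 \<le> d i x * layer n i x" by (auto intro!: mult_nonneg_nonneg layer_nonneg simp: D_def less_imp_le)
      then show "norm (d i x * layer n i x) \<le> 2" using d_layer_le[OF x, of i n] by simp
    qed
  qed auto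
  then show ?thesis by (simp add: layer_int_def)
qed

text \<open>
  Green's formula: on the left, \<open>W h\<close> times the normal component of \<open>e\<close> on the three sides; on the
  right, the divergence of the vector field \<open>W h e\<close>. It follows from testing the weak gradient with
  \<open>cutoff n x * h x\<close> and letting the cutoff tend to \<open>1\<close>.
\<close>

lemma tendsto_boundary_flux:
  assumes W: "integrable (lebesgue_on D) W" and g: "\<And>i. integrable (lebesgue_on D) (\<lambda>x. g x $ i)"
    and wg: "weak_gradient D W g" and h: "smooth h"
  shows "(\<lambda>n. \<Sum>i\<in>UNIV. (m i \<bullet> e) * layer_int n i (\<lambda>x. W x * h x))
    \<longlonglongrightarrow> - (LINT x|lebesgue_on D. W x * dirderiv e h x + (g x \<bullet> e) * h x)"
proof -
  have ge: "integrable (lebesgue_on D) (\<lambda>x. g x \<bullet> e)"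
    unfolding inner_vec_def using g by simp
  let ?F = "\<lambda>x. W x * dirderiv e h x + (g x \<bullet> e) * h x"
  have F: "integrable (lebesgue_on D) ?F"
    using W ge h D_facts by (intro Bochner_Integration.integrable_add integrable_mult_smooth smooth_dirderiv)
  have Wh: "integrable (lebesgue_on D) (\<lambda>x. W x * h x)"
    using W h D_facts by (intro integrable_mult_smooth)
  have eq: "(\<Sum>i\<in>UNIV. (m i \<bullet> e) * layer_int n i (\<lambda>x. W x * h x)) = - (LINT x|lebesgue_on D. ?F x * cutoff n x)" for n
  proof -
    have t: "test_function D (\<lambda>x. cutoff n x * h x)"
      by (rule test_function_mult[OF test_function_cutoff h])
    have "(\<Sum>i\<in>UNIV. (m i \<bullet> e) * layer_int n i (\<lambda>x. W x * h x)) = (LINT x|lebesgue_on D. (\<Sum>i\<in>UNIV. (m i \<bullet> e) * (W x * h x * layer n i x)))"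
      unfolding layer_int_def using integrable_layer[OF Wh] by simp
    also have "\<dots> = (LINT x|lebesgue_on D. W x * dirderiv e (\<lambda>x. cutoff n x * h x) x - W x * dirderiv e h x * cutoff n x)"
      by (simp add: dirderiv_mult smooth_cutoff h dirderiv_cutoff sum_distrib_left sum_distrib_right algebra_simps)
    also have "\<dots> = (LINT x|lebesgue_on D. W x * dirderiv e (\<lambda>x. cutoff n x * h x) x) - (LINT x|lebesgue_on D. W x * dirderiv e h x * cutoff n x)"
      using W h D_facts t by (intro Bochner_Integration.integral_diff integrable_mult_smooth smooth_dirderiv smooth_cutoff smooth_mult)
    also have "(LINT x|lebesgue_on D. W x * dirderiv e (\<lambda>x. cutoff n x * h x) x) = - (LINT x|lebesgue_on D. (g x \<bullet> e) * (cutoff n x * h x))"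
      by (rule weak_gradient_dirderiv[OF wg D_facts(3,4) W g t])
    also have "(LINT x|lebesgue_on D. (g x \<bullet> e) * (cutoff n x * h x)) = (LINT x|lebesgue_on D. (g x \<bullet> e) * h x * cutoff n x)"
      by (simp add: mult_ac)
    also have "- (LINT x|lebesgue_on D. (g x \<bullet> e) * h x * cutoff n x) - (LINT x|lebesgue_on D. W x * dirderiv e h x * cutoff n x)
        = - ((LINT x|lebesgue_on D. W x * dirderiv e h x * cutoff n x) + (LINT x|lebesgue_on D. (g x \<bullet> e) * h x * cutoff n x))" by simp
    also have "(LINT x|lebesgue_on D. W x * dirderiv e h x * cutoff n x) + (LINT x|lebesgue_on D. (g x \<bullet> e) * h x * cutoff n x)
        = (LINT x|lebesgue_on D. W x * dirderiv e h x * cutoff n x + (g x \<bullet> e) * h x * cutoff n x)"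
      using W ge h D_facts by (intro Bochner_Integration.integral_add[symmetric] integrable_mult_smooth smooth_dirderiv smooth_cutoff)
    finally show ?thesis by (simp add: distrib_right)
  qed
  have "(\<lambda>n. LINT x|lebesgue_on D. ?F x * cutoff n x) \<longlonglongrightarrow> integral\<^sup>L (lebesgue_on D) ?F"
  proof (rule integral_dominated_convergence[where w = "\<lambda>x. \<bar>?F x\<bar>"])
    show "?F \<in> borel_measurable (lebesgue_on D)" using F by auto
    show "(\<lambda>x. ?F x * cutoff n x) \<in> borel_measurable (lebesgue_on D)" for n
      using integrable_mult_smooth[OF F smooth_cutoff D_facts(3,4)] by auto
    show "integrable (lebesgue_on D) (\<lambda>x. \<bar>?F x\<bar>)" using F by auto
    show "AE x in lebesgue_on D. (\<lambda>n. ?F x * cutoff n x) \<longlonglongrightarrow> ?F x"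
      using tendsto_mult[OF tendsto_const cutoff_tendsto] by (intro AE_I2) fastforce
    show "AE x in lebesgue_on D. norm (?F x * cutoff n x) \<le> \<bar>?F x\<bar>" for n
      unfolding real_norm_def abs_mult using cutoff_bounds[of n] by (intro AE_I2 mult_left_le) auto
  qed
  then show ?thesis unfolding eq by (rule tendsto_minus)
qed

text \<open>
  The same formula for the vector field \<open>\<Sum>i. h i *\<^sub>R m i\<close>, whose component normal to side \<open>j\<close> is the
  sum on the left.
\<close>

lemma tendsto_boundary_flux_field:
  assumes W: "integrable (lebesgue_on D) W" and g: "\<And>i. integrable (lebesgue_on D) (\<lambda>x. g x $ i)"
    and wg: "weak_gradient D W g" and h: "\<And>i. smooth (h i)"
  shows "(\<lambda>n. \<Sum>j\<in>UNIV. layer_int n j (\<lambda>x. W x * (\<Sum>i\<in>UNIV. (m j \<bullet> m i) * h i x)))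
    \<longlonglongrightarrow> - (LINT x|lebesgue_on D. W x * (\<Sum>i\<in>UNIV. dirderiv (m i) (h i) x) + (\<Sum>i\<in>UNIV. (g x \<bullet> m i) * h i x))"
proof -
  have ge: "integrable (lebesgue_on D) (\<lambda>x. g x \<bullet> e)" for e
    unfolding inner_vec_def using g by simp
  have "(\<lambda>n. \<Sum>i\<in>UNIV. \<Sum>j\<in>UNIV. (m j \<bullet> m i) * layer_int n j (\<lambda>x. W x * h i x))
    \<longlonglongrightarrow> (\<Sum>i\<in>UNIV. - (LINT x|lebesgue_on D. W x * dirderiv (m i) (h i) x + (g x \<bullet> m i) * h i x))"
    by (intro tendsto_sum tendsto_boundary_flux assms)
  also have "(\<Sum>i\<in>UNIV. - (LINT x|lebesgue_on D. W x * dirderiv (m i) (h i) x + (g x \<bullet> m i) * h i x))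
    = - (LINT x|lebesgue_on D. (\<Sum>i\<in>UNIV. W x * dirderiv (m i) (h i) x + (g x \<bullet> m i) * h i x))"
    unfolding sum_negf using W ge h D_facts
    by (subst Bochner_Integration.integral_sum)
       (auto intro!: Bochner_Integration.integrable_add integrable_mult_smooth smooth_dirderiv)
  also have "(\<lambda>n. \<Sum>i\<in>UNIV. \<Sum>j\<in>UNIV. (m j \<bullet> m i) * layer_int n j (\<lambda>x. W x * h i x)) =
    (\<lambda>n. \<Sum>j\<in>UNIV. layer_int n j (\<lambda>x. W x * (\<Sum>i\<in>UNIV. (m j \<bullet> m i) * h i x)))"
  proof
    fix n
    have "(\<Sum>i\<in>UNIV. \<Sum>j\<in>UNIV. (m j \<bullet> m i) * layer_int n j (\<lambda>x. W x * h i x)) =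
      (\<Sum>j\<in>UNIV. \<Sum>i\<in>UNIV. layer_int n j (\<lambda>x. (m j \<bullet> m i) * (W x * h i x)))"
      unfolding layer_int_cmult by (rule sum.swap)
    also have "\<dots> = (\<Sum>j\<in>UNIV. layer_int n j (\<lambda>x. \<Sum>i\<in>UNIV. (m j \<bullet> m i) * (W x * h i x)))"
      using W h D_facts by (subst layer_int_sum) (auto intro!: integrable_mult_smooth)
    also have "\<dots> = (\<Sum>j\<in>UNIV. layer_int n j (\<lambda>x. W x * (\<Sum>i\<in>UNIV. (m j \<bullet> m i) * h i x)))"
      by (simp add: sum_distrib_left mult.left_commute)
    finally show "(\<Sum>i\<in>UNIV. \<Sum>j\<in>UNIV. (m j \<bullet> m i) * layer_int n j (\<lambda>x. W x * h i x)) =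
      (\<Sum>j\<in>UNIV. layer_int n j (\<lambda>x. W x * (\<Sum>i\<in>UNIV. (m j \<bullet> m i) * h i x)))" .
  qed
  finally show ?thesis by (simp add: sum.distrib sum_distrib_left)
qed

lemma layer_int_nonneg: "(\<And>x. x \<in> D \<Longrightarrow> 0 \<le> H x) \<Longrightarrow> 0 \<le> layer_int n i H"
  unfolding layer_int_def by (intro integral_nonneg_AE AE_I2 mult_nonneg_nonneg layer_nonneg) auto

lemma integrable_const_D: "integrable (lebesgue_on D) (\<lambda>_. c :: real)"
  by (intro integrable_lebesgue_on_smooth smooth_const D_facts)

text \<open>
  Green's formula for \<open>W = 1\<close> and the field with coefficients \<open>d i - r\<close>. Its divergence is constant,
  while its normal component on side \<open>j\<close> is \<open>3/2 (d j - r)\<close>, which is \<open>- 3/2 r\<close> up to a multiple of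
  \<open>d j\<close>, and \<open>d j\<close> has vanishing integrals in the limit. So the total mass converges.
\<close>

lemma boundary_mass_bounded:
  obtains M where "0 < M" "\<And>n i. layer_int n i (\<lambda>_. 1) \<le> M"
proof -
  let ?h = "\<lambda>i x. d i x + (- r)"
  have sm: "smooth (?h i)" for i by (intro smooth_add smooth_d smooth_const)
  have "(\<Sum>i\<in>UNIV. (m j \<bullet> m i) * ?h i x) = 3 / 2 * d j x + (- 3 / 2 * r)" for j x
    unfolding sum_inner_m by (simp add: sum.distrib sum_subtractf sum_d algebra_simps)
  moreover have "layer_int n j (\<lambda>x. 3 / 2 * d j x + (- 3 / 2 * r)) = 3 / 2 * layer_int n j (d j) + (- 3 / 2 * r) * layer_int n j (\<lambda>_. 1)" for n j
  proof -
    have "layer_int n j (\<lambda>x. 3 / 2 * d j x + (- 3 / 2 * r) * 1) = 3 / 2 * layer_int n j (d j) + (- 3 / 2 * r) * layer_int n j (\<lambda>_. 1)"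
      by (subst layer_int_add)
         (auto simp only: layer_int_cmult intro!: integrable_lebesgue_on_smooth smooth_mult smooth_const smooth_d D_facts)
    then show ?thesis by simp
  qed
  moreover note tendsto_boundary_flux_field[where W = "\<lambda>_. 1" and g = "\<lambda>_. 0" and h = ?h, OF _ _ _ sm]
  ultimately have "convergent (\<lambda>n. \<Sum>j\<in>UNIV. 3 / 2 * layer_int n j (d j) + (- 3 / 2 * r) * layer_int n j (\<lambda>_. 1))"
    unfolding convergent_def
    using weak_gradient_const[OF D_facts(4)] integrable_const_D by (auto simp: zero_vec_def)
  moreover have "convergent (\<lambda>n. \<Sum>j\<in>UNIV. layer_int n j (d j))"
    by (rule convergentI[OF tendsto_sum[OF tendsto_layer_int_d]])
  ultimately have "convergent (\<lambda>n. (- 2 / (3 * r)) * ((\<Sum>j\<in>UNIV. 3 / 2 * layer_int n j (d j) + (- 3 / 2 * r) * layer_int n j (\<lambda>_. 1)) - 3 / 2 * (\<Sum>j\<in>UNIV. layer_int n j (d j))))"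
    by (intro convergent_mult convergent_diff convergent_const)
  moreover have "(- 2 / (3 * r)) * ((\<Sum>j\<in>UNIV. 3 / 2 * layer_int n j (d j) + (- 3 / 2 * r) * layer_int n j (\<lambda>_. 1)) - 3 / 2 * (\<Sum>j\<in>UNIV. layer_int n j (d j)))
    = (\<Sum>j\<in>UNIV. layer_int n j (\<lambda>_. 1))" for n
    using r_pos by (simp add: sum_3 field_simps)
  ultimately have "Bseq (\<lambda>n. \<Sum>j\<in>UNIV. layer_int n j (\<lambda>_. 1))"
    by (intro convergent_imp_Bseq) simp
  then obtain M where M: "0 < M" "\<And>n. norm (\<Sum>j\<in>UNIV. layer_int n j (\<lambda>_. 1)) \<le> M" by (auto elim: BseqE)
  have "layer_int n i (\<lambda>_. 1) \<le> M" for n i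
  proof -
    have "layer_int n i (\<lambda>_. 1) \<le> (\<Sum>j\<in>UNIV. layer_int n j (\<lambda>_. 1))"
      by (rule member_le_sum) (auto intro: layer_int_nonneg)
    then show ?thesis using M(2)[of n] by simp
  qed
  with M(1) show ?thesis by (rule that)
qed

text \<open>
  By compactness, \<open>H \<le> - \<tau>\<close> is possible only at a positive distance from the side, and there a large
  multiple of the distance dominates \<open>- H\<close>.
\<close>

lemma lower_bound_by_distance:
  assumes H: "continuous_on T H" and side: "\<And>x. x \<in> T \<Longrightarrow> d i x = 0 \<Longrightarrow> 0 \<le> H x" and \<tau>: "0 < \<tau>"
  obtains C where "0 \<le> C" "\<And>x. x \<in> T \<Longrightarrow> - \<tau> - C * d i x \<le> H x"
proof -
  define S where "S = {x \<in> T. H x \<le> - \<tau>}"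
  have "closedin (top_of_set T) S"
    unfolding S_def using H by (intro continuous_closedin_preimage[of T H "{..- \<tau>}", simplified vimage_def Int_def, simplified]) auto
  then have S: "compact S" using compact_T closedin_compact by blast
  show ?thesis
  proof (cases "S = {}")
    case True
    then have "- \<tau> - 0 * d i x \<le> H x" if "x \<in> T" for x using that by (auto simp: S_def not_le less_imp_le)
    then show ?thesis using that[of 0] by blast
  next
    case False
    obtain x0 where x0: "x0 \<in> S" "\<And>x. x \<in> S \<Longrightarrow> d i x0 \<le> d i x"
      using continuous_attains_inf[OF S False smooth_continuous[OF smooth_d]] by metis
    obtain x1 where x1: "x1 \<in> S" "\<And>x. x \<in> S \<Longrightarrow> H x1 \<le> H x"
      using continuous_attains_inf[OF S False, of H] H continuous_on_subset[of T H S] by (auto simp: S_def)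
    have "0 < d i x0"
      using x0(1) side[of x0] \<tau> by (force simp: S_def T_def less_le)
    define C where "C = - H x1 / d i x0"
    have "H x1 < 0" using x1(1) \<tau> by (auto simp: S_def)
    then have C: "0 \<le> C" using \<open>0 < d i x0\<close> by (auto simp: C_def divide_nonpos_pos)
    have "- \<tau> - C * d i x \<le> H x" if "x \<in> T" for x
    proof (cases "x \<in> S")
      case True
      have "- H x1 = C * d i x0" using \<open>0 < d i x0\<close> by (simp add: C_def)
      also have "\<dots> \<le> C * d i x" using x0(2)[OF True] C by (rule mult_left_mono)
      finally show ?thesis using x1(2)[OF True] \<tau> by simp
    next
      case False
      then have "- \<tau> < H x" using that by (auto simp: S_def)
      moreover have "0 \<le> C * d i x" using C that by (auto simp: T_def)
      ultimately show ?thesis by simp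
    qed
    then show ?thesis using that C by blast
  qed
qed

lemma eventually_layer_int_ge:
  assumes H: "continuous_on T H" and side: "\<And>x. x \<in> T \<Longrightarrow> d i x = 0 \<Longrightarrow> 0 \<le> H x" and \<tau>: "0 < \<tau>"
  shows "\<forall>\<^sub>F n in sequentially. - \<tau> < layer_int n i H"
proof -
  obtain M where M: "0 < M" "\<And>n i. layer_int n i (\<lambda>_. 1) \<le> M" using boundary_mass_bounded by blast
  obtain C where C: "0 \<le> C" "\<And>x. x \<in> T \<Longrightarrow> - (\<tau> / (2 * M)) - C * d i x \<le> H x"
    using lower_bound_by_distance[OF H side, where \<tau> = "\<tau> / (2 * M)"] \<tau> M(1) by auto
  have "(\<lambda>n. - \<tau> / 2 + (- C) * layer_int n i (d i)) \<longlonglongrightarrow> - \<tau> / 2 + (- C) * 0"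
    by (intro tendsto_intros tendsto_layer_int_d)
  then have "\<forall>\<^sub>F n in sequentially. - \<tau> < - \<tau> / 2 + (- C) * layer_int n i (d i)"
    by (rule order_tendstoD) (use \<tau> in simp)
  then show ?thesis
  proof (rule eventually_mono)
    fix n assume *: "- \<tau> < - \<tau> / 2 + (- C) * layer_int n i (d i)"
    have "layer_int n i (\<lambda>x. (- (\<tau> / (2 * M))) * 1 + (- C) * d i x) \<le> layer_int n i H"
    proof (rule layer_int_mono)
      show "integrable (lebesgue_on D) (\<lambda>x. (- (\<tau> / (2 * M))) * 1 + (- C) * d i x)"
        by (intro integrable_T continuous_intros smooth_continuous smooth_d)
      show "integrable (lebesgue_on D) H" by (rule integrable_T[OF H])
      show "(- (\<tau> / (2 * M))) * 1 + (- C) * d i x \<le> H x" if "x \<in> D" for x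
        using C(2)[of x] D_subset_T that by auto
    qed
    also have "layer_int n i (\<lambda>x. (- (\<tau> / (2 * M))) * 1 + (- C) * d i x) = (- (\<tau> / (2 * M))) * layer_int n i (\<lambda>_. 1) + (- C) * layer_int n i (d i)"
      unfolding layer_int_cmult[symmetric] by (rule layer_int_add) (intro integrable_T continuous_intros smooth_continuous smooth_d)+
    finally have "(- (\<tau> / (2 * M))) * layer_int n i (\<lambda>_. 1) + (- C) * layer_int n i (d i) \<le> layer_int n i H" .
    moreover have "\<tau> / (2 * M) * layer_int n i (\<lambda>_. 1) \<le> \<tau> / (2 * M) * M"
      using M \<tau> by (intro mult_left_mono) auto
    then have "\<tau> / (2 * M) * layer_int n i (\<lambda>_. 1) \<le> \<tau> / 2" using M(1) by simp
    ultimately show "- \<tau> < layer_int n i H" using * by simp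
  qed
qed

lemma tendsto_layer_int_zero:
  assumes H: "continuous_on T H" and side: "\<And>x. x \<in> T \<Longrightarrow> d i x = 0 \<Longrightarrow> H x = 0"
  shows "(\<lambda>n. layer_int n i H) \<longlonglongrightarrow> 0"
proof (rule tendstoI)
  fix \<tau> :: real assume \<tau>: "0 < \<tau>"
  have "\<forall>\<^sub>F n in sequentially. - \<tau> < layer_int n i (\<lambda>x. - 1 * H x)"
    using H side by (intro eventually_layer_int_ge \<tau> continuous_intros) auto
  moreover have "\<forall>\<^sub>F n in sequentially. - \<tau> < layer_int n i H"
    using H side by (intro eventually_layer_int_ge \<tau>) auto
  ultimately show "\<forall>\<^sub>F n in sequentially. dist (layer_int n i H) 0 < \<tau>"
    by eventually_elim (simp only: layer_int_cmult, simp add: abs_less_iff)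
qed

text \<open>
  Green's formula in the direction \<open>m i\<close>. The other two sides contribute with the factor \<open>- 1/2\<close>, so
  the integral at side \<open>i\<close> is at least the total flux. On the part of \<open>D\<close> where a bump centred on side \<open>i\<close>
  is positive, it decreases in the direction \<open>m i\<close>, which makes the flux positive in the limit.
\<close>

lemma layer_int_bump_bounded_below:
  assumes p: "p \<in> T" "d i p = 0" and \<rho>: "0 < \<rho>"
  obtains c where "0 < c" "\<forall>\<^sub>F n in sequentially. c < layer_int n i (bump \<rho> p)"
proof -
  define I where "I = (LINT x|lebesgue_on D. - dirderiv (m i) (bump \<rho> p) x)"
  have nn: "- dirderiv (m i) (bump \<rho> p) x = flat [:0, 0, 1:] (\<rho>\<^sup>2 - (x - p) \<bullet> (x - p)) * (2 * d i x)" for x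
  proof -
    have "(x - p) \<bullet> m i = d i x"
      using p(2) by (simp add: d_def inner_diff_right inner_commute algebra_simps)
    then show ?thesis by (simp add: dirderiv_bump)
  qed
  have "0 < I" unfolding I_def
  proof (rule integral_lebesgue_on_pos[where U = "D \<inter> ball p \<rho>"])
    show "integrable (lebesgue_on D) (\<lambda>x. - dirderiv (m i) (bump \<rho> p) x)"
      by (intro Bochner_Integration.integrable_minus integrable_lebesgue_on_smooth smooth_dirderiv smooth_bump D_facts)
    show "0 \<le> - dirderiv (m i) (bump \<rho> p) x" if "x \<in> D" for x
      unfolding nn using that by (auto simp: D_def less_imp_le intro!: mult_nonneg_nonneg flat_nonneg)
    show "0 < - dirderiv (m i) (bump \<rho> p) x" if "x \<in> D \<inter> ball p \<rho>" for x
    proof -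
      have "0 < \<rho>\<^sup>2 - (x - p) \<bullet> (x - p)" using in_ball_iff_inner[OF \<rho>] that by blast
      then have "0 < flat [:0, 0, 1:] (\<rho>\<^sup>2 - (x - p) \<bullet> (x - p))" by (simp add: flat_def)
      then show ?thesis unfolding nn using that by (auto simp: D_def)
    qed
    have "p \<in> closure D" using p(1) by (simp add: closure_D)
    then obtain y where "y \<in> D" "dist y p < \<rho>" using \<rho> closure_approachable by metis
    then show "D \<inter> ball p \<rho> \<noteq> {}" by (auto simp: dist_commute)
  qed (use D_facts in auto)
  have "(\<lambda>n. \<Sum>j\<in>UNIV. (m j \<bullet> m i) * layer_int n j (\<lambda>x. 1 * bump \<rho> p x)) \<longlonglongrightarrow>
      - (LINT x|lebesgue_on D. 1 * dirderiv (m i) (bump \<rho> p) x + (0 \<bullet> m i) * bump \<rho> p x)"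
    by (rule tendsto_boundary_flux[OF integrable_const_D _ weak_gradient_const[OF D_facts(4)] smooth_bump]) simp
  then have lim: "(\<lambda>n. \<Sum>j\<in>UNIV. (m j \<bullet> m i) * layer_int n j (bump \<rho> p)) \<longlonglongrightarrow> I"
    by (simp add: I_def)
  have "(\<Sum>j\<in>UNIV. (m j \<bullet> m i) * layer_int n j (bump \<rho> p)) \<le> layer_int n i (bump \<rho> p)" for n
  proof -
    have "(\<Sum>j\<in>UNIV. (m j \<bullet> m i) * layer_int n j (bump \<rho> p)) \<le> (\<Sum>j\<in>UNIV. if j = i then layer_int n j (bump \<rho> p) else 0)"
      using layer_int_nonneg[of "bump \<rho> p" n] bump_nonneg by (intro sum_mono) (auto simp: inner_m)
    then show ?thesis by simp
  qed
  moreover have "\<forall>\<^sub>F n in sequentially. I / 2 < (\<Sum>j\<in>UNIV. (m j \<bullet> m i) * layer_int n j (bump \<rho> p))"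
    using lim by (rule order_tendstoD) (use \<open>0 < I\<close> in simp)
  ultimately have "\<forall>\<^sub>F n in sequentially. I / 2 < layer_int n i (bump \<rho> p)"
    by (auto elim!: eventually_mono intro: less_le_trans)
  then show ?thesis using \<open>0 < I\<close> by (intro that[of "I / 2"]) auto
qed

text \<open>
  Near \<open>p\<close> the function \<open>H\<close> exceeds a small multiple of a bump, and after subtracting this multiple it
  is still nonnegative on the side.
\<close>

lemma layer_int_bounded_below:
  assumes H: "continuous_on T H" and side: "\<And>x. x \<in> T \<Longrightarrow> d i x = 0 \<Longrightarrow> 0 \<le> H x"
    and p: "p \<in> T" "d i p = 0" "0 < H p"
  obtains c where "0 < c" "\<forall>\<^sub>F n in sequentially. c < layer_int n i H"
proof -
  define \<delta> where "\<delta> = H p / 2"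
  have \<delta>: "0 < \<delta>" using p(3) by (simp add: \<delta>_def)
  obtain \<rho> where \<rho>: "0 < \<rho>" "\<And>x. x \<in> T \<Longrightarrow> dist x p < \<rho> \<Longrightarrow> dist (H x) (H p) < \<delta>"
    using H p(1) \<delta> unfolding continuous_on_iff by metis
  obtain c where c: "0 < c" "\<forall>\<^sub>F n in sequentially. c < layer_int n i (bump \<rho> p)"
    using layer_int_bump_bounded_below[OF p(1,2) \<rho>(1)] by metis
  have cont: "continuous_on T (\<lambda>x. H x + (- \<delta>) * bump \<rho> p x)"
    by (intro continuous_intros H smooth_continuous smooth_bump)
  have nn: "0 \<le> H x + (- \<delta>) * bump \<rho> p x" if "x \<in> T" "d i x = 0" for x
  proof (cases "dist x p < \<rho>")
    case True
    have "\<delta> \<le> H x" using \<rho>(2)[OF that(1) True] unfolding dist_real_def \<delta>_def by linarith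
    moreover have "\<delta> * bump \<rho> p x \<le> \<delta>" using \<delta> by (intro mult_left_le) (auto simp: bump_def flat_1_bounds)
    ultimately show ?thesis by simp
  next
    case False
    then have "bump \<rho> p x = 0" using bump_eq_0_iff[OF \<rho>(1), of p x] by (simp add: dist_commute)
    then show ?thesis using side[OF that] by simp
  qed
  have eq: "layer_int n i (\<lambda>x. H x + (- \<delta>) * bump \<rho> p x) = layer_int n i H + (- \<delta>) * layer_int n i (bump \<rho> p)" for n
    unfolding layer_int_cmult[symmetric]
    by (rule layer_int_add) (intro integrable_T H continuous_intros smooth_continuous smooth_bump)+
  have "\<forall>\<^sub>F n in sequentially. - (\<delta> * c / 2) < layer_int n i (\<lambda>x. H x + (- \<delta>) * bump \<rho> p x)"
    using c \<delta> nn by (intro eventually_layer_int_ge cont) auto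
  then have "\<forall>\<^sub>F n in sequentially. \<delta> * c / 2 < layer_int n i H"
    using c(2)
  proof eventually_elim
    case (elim n)
    have "\<delta> * c < \<delta> * layer_int n i (bump \<rho> p)" using elim(2) \<delta> by simp
    then show ?case using elim(1) unfolding eq by simp
  qed
  then show ?thesis using \<delta> c(1) by (intro that[of "\<delta> * c / 2"]) auto
qed

section \<open>Boundary values of eigenfunctions\<close>

text \<open>
  The inward normal derivative of \<open>\<Sum>i. sin (k d\<^sub>i)\<close> has isolated zeros on each side. A short step
  along the side, in the direction \<open>m l - m i\<close>, leaves them and keeps \<open>w\<close> positive.
\<close>

lemma boundary_perturbation:
  fixes w :: "real^2 \<Rightarrow> real"
  assumes w: "continuous_on T w" and p: "p \<in> T" "d j p = 0" "0 < w p" and k: "0 < k"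
  obtains q i where "q \<in> T" "d j q = 0" "0 < w q" "cos (k * d i q) \<noteq> 1"
proof -
  have "\<exists>i. i \<noteq> j \<and> 0 < d i p"
  proof (rule ccontr)
    assume "\<not> ?thesis"
    then have "(\<Sum>i\<in>UNIV. d i p) \<le> 0" using p(2) by (intro sum_nonpos) (metis not_less order_refl)
    then show False using r_pos by (simp add: sum_d)
  qed
  then obtain i where i: "i \<noteq> j" "0 < d i p" by blast
  then obtain l where l: "l \<noteq> i" "l \<noteq> j" "\<And>k. k = i \<or> k = j \<or> k = l" using third_index[OF i(1)] by blast
  define q where "q t = p + t *\<^sub>R (m l - m i)" for t :: real
  have dq: "d i (q t) = d i p - 3 / 2 * t" "d j (q t) = 0" "d l (q t) = d l p + 3 / 2 * t" for t
    unfolding q_def d_add using i l p(2) by (auto simp: inner_diff_right inner_m)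
  obtain \<rho> where \<rho>: "0 < \<rho>" "\<And>x. x \<in> T \<Longrightarrow> dist x p < \<rho> \<Longrightarrow> dist (w x) (w p) < w p"
    using w p(1,3) unfolding continuous_on_iff by metis
  have nz: "0 < norm (m l - m i)"
  proof -
    have "m l \<bullet> m l \<noteq> m i \<bullet> m l" using l by (simp add: inner_m)
    then show ?thesis by auto
  qed
  \<comment> \<open>Small enough to stay in the triangle, to keep \<open>w\<close> positive, and to change \<open>k * d i\<close> by less than a period.\<close>
  define t where "t = min (d i p / 2) (min (\<rho> / (2 * norm (m l - m i))) (1 / k))"
  have t: "0 < t" "t \<le> d i p / 2" "t \<le> \<rho> / (2 * norm (m l - m i))" "t \<le> 1 / k"
    using i(2) \<rho>(1) nz k by (auto simp: t_def)
  have good: "q t' \<in> T \<and> 0 < w (q t')" if "0 \<le> t'" "t' \<le> t" for t'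
  proof -
    have "0 \<le> d a (q t')" for a
      using l(3)[of a] dq[of t'] that t(2) i(2) p(1) by (auto simp: T_def)
    then have qT: "q t' \<in> T" by (simp add: T_def)
    have "dist (q t') p = t' * norm (m l - m i)" using that by (simp add: q_def dist_norm)
    also have "\<dots> \<le> \<rho> / (2 * norm (m l - m i)) * norm (m l - m i)"
      using that t(3) by (intro mult_right_mono) auto
    also have "\<dots> < \<rho>" using nz \<rho>(1) by simp
    finally have "dist (w (q t')) (w p) < w p" using \<rho>(2)[OF qT] by blast
    then show ?thesis using qT by (auto simp: dist_real_def)
  qed
  have "cos (k * d i (q 0)) \<noteq> 1 \<or> cos (k * d i (q t)) \<noteq> 1"
  proof -
    have "0 < k * (3 / 2 * t)" using k t(1) by simp
    moreover have "k * t \<le> 1" using t(4) k by (simp add: pos_le_divide_eq mult.commute)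
    then have "k * (3 / 2 * t) < 2 * pi" using pi_gt3 by simp
    ultimately show ?thesis using cos_eq_1_shift[of "k * d i p" "k * (3 / 2 * t)"] by (auto simp: dq right_diff_distrib)
  qed
  then show ?thesis using that[of "q 0" i] that[of "q t" i] good[of 0] good[of t] t(1) dq(2) by auto
qed

text \<open>
  Green's formula loses its boundary term, since \<open>w\<close> vanishes on the boundary.
\<close>

lemma integral_product_rule_boundary_zero:
  assumes "continuous_on T w" "weak_gradient D w g" "\<And>i. integrable (lebesgue_on D) (\<lambda>x. g x $ i)"
    and "smooth h" and zero: "\<And>x. x \<in> T - D \<Longrightarrow> w x = 0"
  shows "(LINT x|lebesgue_on D. w x * dirderiv e h x + (g x \<bullet> e) * h x) = 0"
proof -
  have "(\<lambda>n. layer_int n i (\<lambda>x. w x * h x)) \<longlonglongrightarrow> 0" for i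
  proof (rule tendsto_layer_int_zero)
    show "continuous_on T (\<lambda>x. w x * h x)"
      by (intro continuous_intros assms smooth_continuous)
    show "w x * h x = 0" if "x \<in> T" "d i x = 0" for x
    proof -
      have "x \<notin> D" using that(2) by (blast dest: d_nonzero)
      then show ?thesis using zero that by simp
    qed
  qed
  then have "(\<lambda>n. \<Sum>i\<in>UNIV. (m i \<bullet> e) * layer_int n i (\<lambda>x. w x * h x)) \<longlonglongrightarrow> (\<Sum>i\<in>UNIV. (m i \<bullet> e) * 0)"
    by (intro tendsto_intros)
  with tendsto_boundary_flux[OF integrable_T[OF assms(1)] assms(3,2,4), of e]
  show ?thesis using LIMSEQ_unique by fastforce
qed

text \<open>
  Green's formula for the field with coefficients \<open>cos (k d\<^sub>i)\<close>, that is for \<open>\<nabla>v / k\<close> with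
  \<open>v = (\<Sum>i. sin (k d\<^sub>i))\<close>. Its interior term vanishes by the eigenvalue equation tested with \<open>v\<close>, and
  its normal component \<open>Q j\<close> is nonnegative on side \<open>j\<close>. If \<open>w\<close> were positive somewhere on the boundary,
  the limit of the boundary terms would be positive.
\<close>

lemma boundary_zero:
  assumes w: "continuous_on T w" and wg: "weak_gradient D w g" and g: "\<And>i. integrable (lebesgue_on D) (\<lambda>x. g x $ i)"
    and eig: "\<And>v. smooth v \<Longrightarrow> (LINT x|lebesgue_on D. g x \<bullet> gradient v x) = \<mu> * (LINT x|lebesgue_on D. w x * v x)"
    and \<mu>: "0 < \<mu>" and nonneg: "\<And>x. x \<in> T - D \<Longrightarrow> 0 \<le> w x" and x: "x \<in> T - D"
  shows "w x = 0"
proof (rule ccontr)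
  assume "w x \<noteq> 0"
  then have "0 < w x" using nonneg[OF x] by simp
  obtain j where j: "d j x = 0" using x by (auto simp: T_def D_def not_less intro: order_antisym)
  define k where "k = sqrt \<mu>"
  have k: "0 < k" "\<mu> = k * k" using \<mu> by (auto simp: k_def)
  define h where "h i x = cos (k * d i x)" for i x
  define v where "v x = (\<Sum>i\<in>UNIV. sin (k * d i x))" for x
  define Q where "Q j x = (\<Sum>i\<in>UNIV. (m j \<bullet> m i) * h i x)" for j x
  have skd: "smooth (\<lambda>x. k * d i x)" for i by (intro smooth_mult smooth_const smooth_d)
  have sh: "smooth (h i)" for i unfolding h_def[abs_def] by (rule smooth_cos[OF skd])
  have sv: "smooth v" unfolding v_def[abs_def] by (intro smooth_sum smooth_sin skd)
  have sQ: "smooth (Q j)" for j unfolding Q_def[abs_def] by (intro smooth_sum smooth_mult smooth_const sh)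
  have dh: "dirderiv (m i) (h i) x = - k * sin (k * d i x)" for i x
    by (rule dirderiv_eq[where f' = "\<lambda>e. - sin (k * d i x) * (k * (m i \<bullet> e))", THEN trans])
       (auto simp: h_def[abs_def] inner_m intro!: derivative_eq_intros d_has_derivative)
  have dv: "dirderiv e v x = k * (\<Sum>i\<in>UNIV. (e \<bullet> m i) * h i x)" for e x
    by (rule dirderiv_eq[where f' = "\<lambda>e. \<Sum>i\<in>UNIV. cos (k * d i x) * (k * (m i \<bullet> e))", THEN trans])
       (auto simp: v_def[abs_def] h_def inner_commute sum_distrib_left mult_ac intro!: derivative_eq_intros d_has_derivative)
  have Qside: "Q j x = (\<Sum>i\<in>UNIV. 1 - cos (k * d i x)) / 2" if "d j x = 0" for j x
    unfolding Q_def sum_inner_m using that by (simp add: h_def sum_3[of "\<lambda>_. 1"] sum_subtractf)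
  have wQ: "continuous_on T (\<lambda>x. w x * Q j x)" for j
    by (intro continuous_intros w smooth_continuous sQ)
  have wQnn: "0 \<le> w x * Q j x" if "x \<in> T" "d j x = 0" for x j
  proof -
    have "x \<notin> D" using that(2) by (blast dest: d_nonzero)
    then show ?thesis using that nonneg[of x] by (auto simp: Qside intro!: mult_nonneg_nonneg sum_nonneg)
  qed
  have lim: "(\<lambda>n. \<Sum>j\<in>UNIV. layer_int n j (\<lambda>x. w x * Q j x)) \<longlonglongrightarrow> 0"
  proof -
    have ge: "integrable (lebesgue_on D) (\<lambda>x. g x \<bullet> e)" for e
      unfolding inner_vec_def using g by simp
    have "(LINT x|lebesgue_on D. w x * (\<Sum>i\<in>UNIV. dirderiv (m i) (h i) x) + (\<Sum>i\<in>UNIV. (g x \<bullet> m i) * h i x))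
      = (LINT x|lebesgue_on D. (- k) * (w x * v x) + (\<Sum>i\<in>UNIV. (g x \<bullet> m i) * h i x))"
      by (simp add: dh v_def sum_distrib_left sum_negf mult_ac)
    also have "\<dots> = (- k) * (LINT x|lebesgue_on D. w x * v x) + (LINT x|lebesgue_on D. (\<Sum>i\<in>UNIV. (g x \<bullet> m i) * h i x))"
    proof -
      have "integrable (lebesgue_on D) (\<lambda>x. w x * v x)"
        by (rule integrable_mult_smooth[OF integrable_T[OF w] sv D_facts(3,4)])
      moreover have "integrable (lebesgue_on D) (\<lambda>x. \<Sum>i\<in>UNIV. (g x \<bullet> m i) * h i x)"
        by (intro Bochner_Integration.integrable_sum integrable_mult_smooth ge sh D_facts)
      ultimately show ?thesis by simp
    qed
    also have "k * (LINT x|lebesgue_on D. (\<Sum>i\<in>UNIV. (g x \<bullet> m i) * h i x)) = k * k * (LINT x|lebesgue_on D. w x * v x)"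
      using eig[OF sv] by (simp add: inner_gradient[OF sv] dv k(2))
    then have "(LINT x|lebesgue_on D. (\<Sum>i\<in>UNIV. (g x \<bullet> m i) * h i x)) = k * (LINT x|lebesgue_on D. w x * v x)"
      using k(1) by simp
    finally have "(LINT x|lebesgue_on D. w x * (\<Sum>i\<in>UNIV. dirderiv (m i) (h i) x) + (\<Sum>i\<in>UNIV. (g x \<bullet> m i) * h i x)) = 0"
      by simp
    then show ?thesis
      using tendsto_boundary_flux_field[where h = h, OF integrable_T[OF w] g wg sh] by (simp add: Q_def)
  qed
  obtain q i where q: "q \<in> T" "d j q = 0" "0 < w q" "cos (k * d i q) \<noteq> 1"
    by (rule boundary_perturbation[OF w _ j \<open>0 < w x\<close> k(1)]) (use x in auto)
  have "0 < (\<Sum>i\<in>UNIV. 1 - cos (k * d i q))"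
    using q(4) by (intro sum_pos2[of _ i]) (auto simp: less_le)
  then have wQq: "0 < w q * Q j q" using q(2,3) by (simp add: Qside)
  obtain c where c: "0 < c" "\<forall>\<^sub>F n in sequentially. c < layer_int n j (\<lambda>x. w x * Q j x)"
    by (rule layer_int_bounded_below[OF wQ wQnn q(1,2) wQq])
  \<comment> \<open>Each of the other two sides can lower the sum by at most \<open>c / 4\<close>, so the sum stays above \<open>c / 2\<close>.\<close>
  have "\<forall>\<^sub>F n in sequentially. - (c / 4) < layer_int n i (\<lambda>x. w x * Q i x)" for i
    using c(1) by (intro eventually_layer_int_ge wQ wQnn) auto
  then have "\<forall>\<^sub>F n in sequentially. \<forall>i. - (c / 4) < layer_int n i (\<lambda>x. w x * Q i x)"
    by (intro eventually_all_finite) auto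
  moreover have "\<forall>\<^sub>F n in sequentially. (\<Sum>j\<in>UNIV. layer_int n j (\<lambda>x. w x * Q j x)) < c / 2"
    using lim by (rule order_tendstoD) (use c in simp)
  ultimately have "\<forall>\<^sub>F n in sequentially. False" using c(2)
  proof eventually_elim
    case (elim n)
    have "(\<Sum>i\<in>UNIV - {j}. - (c / 4)) \<le> (\<Sum>i\<in>UNIV - {j}. layer_int n i (\<lambda>x. w x * Q i x))"
      using elim(1) by (intro sum_mono) (auto intro: less_imp_le)
    moreover have "(\<Sum>i\<in>UNIV. layer_int n i (\<lambda>x. w x * Q i x)) = layer_int n j (\<lambda>x. w x * Q j x) + (\<Sum>i\<in>UNIV - {j}. layer_int n i (\<lambda>x. w x * Q i x))"
      by (simp add: sum.remove)
    moreover have "(\<Sum>i\<in>UNIV - {j}. - (c / 4)) = - (c / 2)" by (simp add: card_Diff_singleton)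
    ultimately show False using elim(2,3) by linarith
  qed
  then show False by simp
qed

end

section \<open>Density of real exponentials\<close>

inductive_set exp_sums :: "('a::real_inner \<Rightarrow> real) set" where
  exp: "(\<lambda>x. c * exp (\<xi> \<bullet> x)) \<in> exp_sums"
| add: "f \<in> exp_sums \<Longrightarrow> g \<in> exp_sums \<Longrightarrow> (\<lambda>x. f x + g x) \<in> exp_sums"

lemma exp_sums_mult:
  assumes "f \<in> exp_sums" "g \<in> exp_sums"
  shows "(\<lambda>x. f x * g x) \<in> exp_sums"
  using assms(1)
proof induction
  case (exp c \<xi>)
  show ?case using assms(2)
  proof induction
    case (exp c' \<xi>')
    have "(\<lambda>x. (c * c') * exp ((\<xi> + \<xi>') \<bullet> x)) \<in> exp_sums" by (rule exp_sums.exp)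
    then show ?case by (simp add: inner_add_left exp_add mult_ac)
  next
    case (add f g)
    from exp_sums.add[OF add.IH] show ?case by (simp add: distrib_left)
  qed
next
  case (add f h)
  from exp_sums.add[OF add.IH] show ?case by (simp add: distrib_right)
qed

lemma continuous_exp_sums: "f \<in> exp_sums \<Longrightarrow> continuous_on A f"
  by (induction rule: exp_sums.induct) (auto intro!: continuous_intros)

lemma exp_sums_function_ring:
  fixes S :: "'a::euclidean_space set"
  assumes "compact S"
  shows "function_ring_on exp_sums S"
proof
  show "(\<lambda>_. c) \<in> exp_sums" for c :: real
    using exp_sums.exp[of c 0] by simp
  fix x y :: 'a assume "x \<noteq> y"
  then have "(x - y) \<bullet> (x - y) \<noteq> 0" by simp
  then have "(x - y) \<bullet> x \<noteq> (x - y) \<bullet> y" by (simp add: inner_diff_right)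
  then show "\<exists>f\<in>exp_sums. f x \<noteq> f y"
    by (intro bexI[OF _ exp_sums.exp[of 1 "x - y"]]) simp
qed (auto intro: assms continuous_exp_sums exp_sums_mult exp_sums.add)

text \<open>
  Approximate \<open>w\<close> itself uniformly by sums of exponentials: then \<open>\<integral> w\<^sup>2 = \<integral> w (w - f)\<close> is arbitrarily small.
\<close>

lemma orthogonal_to_exponentials_imp_AE_zero:
  fixes w :: "real^'n::finite \<Rightarrow> real"
  assumes T: "compact T" "continuous_on T w" and D: "D \<subseteq> T" "D \<in> lmeasurable"
    and orth: "\<And>\<xi>. (LINT x|lebesgue_on D. w x * exp (\<xi> \<bullet> x)) = 0"
  shows "AE x in lebesgue_on D. w x = 0"
proof -
  interpret function_ring_on exp_sums T by (rule exp_sums_function_ring[OF T(1)])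
  have int: "integrable (lebesgue_on D) f" if "continuous_on T f" for f :: "real^'n \<Rightarrow> real"
    by (rule integrable_lebesgue_on_continuous[OF that T(1) D])
  have zero: "(LINT x|lebesgue_on D. w x * f x) = 0" if "f \<in> exp_sums" for f
    using that
  proof induction
    case (exp c \<xi>)
    have "(LINT x|lebesgue_on D. w x * (c * exp (\<xi> \<bullet> x))) = c * (LINT x|lebesgue_on D. w x * exp (\<xi> \<bullet> x))"
      by (simp add: mult.left_commute)
    then show ?case by (simp add: orth)
  next
    case (add f g)
    have "integrable (lebesgue_on D) (\<lambda>x. w x * f x)" "integrable (lebesgue_on D) (\<lambda>x. w x * g x)"
      by (intro int continuous_on_mult T(2) continuous_exp_sums[OF add.hyps(1)] continuous_exp_sums[OF add.hyps(2)])+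
    then show ?case using add.IH by (simp add: distrib_left)
  qed
  have ww: "integrable (lebesgue_on D) (\<lambda>x. w x * w x)"
    by (intro int continuous_intros T)
  define A where "A = (LINT x|lebesgue_on D. \<bar>w x\<bar>)"
  have "0 \<le> A" unfolding A_def by (rule integral_nonneg_AE) simp
  have "(LINT x|lebesgue_on D. w x * w x) \<le> e" if "0 < e" for e
  proof -
    define e' where "e' = e / (A + 1)"
    have e': "0 < e'" using that \<open>0 \<le> A\<close> by (simp add: e'_def)
    obtain f where f: "f \<in> exp_sums" "\<And>x. x \<in> T \<Longrightarrow> \<bar>w x - f x\<bar> < e'"
      using Stone_Weierstrass_basic[OF T(2) e'] by blast
    have cf: "continuous_on T f" by (rule continuous_exp_sums[OF f(1)])
    have "(LINT x|lebesgue_on D. w x * w x) = (LINT x|lebesgue_on D. w x * w x) - (LINT x|lebesgue_on D. w x * f x)"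
      by (simp add: zero[OF f(1)])
    also have "\<dots> = (LINT x|lebesgue_on D. w x * w x - w x * f x)"
      by (intro Bochner_Integration.integral_diff[symmetric] int continuous_intros T cf)
    also have "\<dots> \<le> (LINT x|lebesgue_on D. e' * \<bar>w x\<bar>)"
    proof (intro integral_mono int continuous_intros T cf)
      fix x assume "x \<in> space (lebesgue_on D)"
      then have "\<bar>w x - f x\<bar> \<le> e'" using f(2)[of x] D(1) by auto
      then have "\<bar>w x\<bar> * \<bar>w x - f x\<bar> \<le> \<bar>w x\<bar> * e'" by (intro mult_left_mono) auto
      moreover have "w x * w x - w x * f x \<le> \<bar>w x\<bar> * \<bar>w x - f x\<bar>"
        using abs_ge_self[of "w x * (w x - f x)"] by (simp add: abs_mult[symmetric] right_diff_distrib)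
      ultimately show "w x * w x - w x * f x \<le> e' * \<bar>w x\<bar>" by (simp add: mult.commute)
    qed
    also have "\<dots> = e' * A" by (simp add: A_def)
    also have "\<dots> \<le> e" using \<open>0 \<le> A\<close> that by (simp add: e'_def pos_divide_le_eq algebra_simps)
    finally show ?thesis .
  qed
  then have "(LINT x|lebesgue_on D. w x * w x) \<le> 0" by (rule field_le_epsilon[of _ 0, simplified])
  moreover have "0 \<le> (LINT x|lebesgue_on D. w x * w x)" by (rule integral_nonneg_AE) simp
  ultimately have "AE x in lebesgue_on D. w x * w x = 0"
    using integral_nonneg_eq_0_iff_AE[OF ww] by simp
  then show ?thesis by simp
qed

section \<open>Normals of an equilateral triangle and the conclusion\<close>

lemma orthogonal_to_basis_2:
  fixes A B u :: "real^2"
  assumes "A \<bullet> A = p" "B \<bullet> B = p" "A \<bullet> B = - p / 2" "0 < p" "u \<bullet> A = 0" "u \<bullet> B = 0"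
  shows "u = 0"
proof -
  define D where "D = A $ 1 * B $ 2 - A $ 2 * B $ 1"
  have "D * D = (A \<bullet> A) * (B \<bullet> B) - (A \<bullet> B) * (A \<bullet> B)"
    by (simp add: D_def inner_vec_def sum_2 algebra_simps)
  then have "D * D = 3 / 4 * (p * p)" using assms by simp
  then have "D \<noteq> 0" using assms(4) by auto
  have e: "u $ 1 * A $ 1 + u $ 2 * A $ 2 = 0" "u $ 1 * B $ 1 + u $ 2 * B $ 2 = 0"
    using assms(5,6) by (simp_all add: inner_vec_def sum_2)
  have "u $ 1 * D = (u $ 1 * A $ 1 + u $ 2 * A $ 2) * B $ 2 - (u $ 1 * B $ 1 + u $ 2 * B $ 2) * A $ 2"
    "u $ 2 * D = (u $ 1 * B $ 1 + u $ 2 * B $ 2) * A $ 1 - (u $ 1 * A $ 1 + u $ 2 * A $ 2) * B $ 1"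
    by (simp_all add: D_def algebra_simps)
  then have "u $ 1 * D = 0" "u $ 2 * D = 0" unfolding e by simp_all
  then have "u $ 1 = 0" "u $ 2 = 0" using \<open>D \<noteq> 0\<close> by simp_all
  then show ?thesis by (simp add: vec_eq_iff forall_2)
qed

text \<open>
  With the centroid \<open>z\<close> as origin the vertices are \<open>V\<^sub>1, V\<^sub>2, V\<^sub>3\<close> with \<open>V\<^sub>i \<bullet> V\<^sub>i = p\<close> and
  \<open>V\<^sub>i \<bullet> V\<^sub>j = - p/2\<close>. The vector \<open>V\<^sub>i\<close> points away from the side opposite to the \<open>i\<close>-th vertex, so it is
  \<open>sqrt p\<close> times the inward normal of that side, and the barycentric coordinates of a point are its
  distances to the sides divided by the height \<open>3 r\<close>.
\<close>

lemma equilateral_triangle_normals: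
  assumes "equilateral_triangle S"
  obtains m z r where "equilateral m z r" "equilateral.T m z r = S"
proof -
  obtain a b c where abc: "a \<noteq> b" "dist a b = dist b c" "dist b c = dist c a" "S = convex hull {a, b, c}"
    using assms by (auto simp: equilateral_triangle_def)
  define z where "z = (1 / 3) *\<^sub>R (a + b + c)"
  define A where "A = a - z"
  define B where "B = b - z"
  define C where "C = - A - B"
  have 3: "z + z + z = a + b + c"
  proof -
    have "z + z + z = (3::real) *\<^sub>R z" by (simp add: scaleR_left.add[of 1 2, simplified] scaleR_2 flip: scaleR_left.add)
    then show ?thesis by (simp add: z_def)
  qed
  then have C: "C = c - z" by (simp add: C_def A_def B_def algebra_simps)
  define p where "p = A \<bullet> A"
  have sq: "(A - B) \<bullet> (A - B) = (B - C) \<bullet> (B - C)" "(B - C) \<bullet> (B - C) = (C - A) \<bullet> (C - A)"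
    using abc(2,3) unfolding C by (simp_all add: A_def B_def dist_norm norm_eq)
  have pos0: "0 < (A - B) \<bullet> (A - B)" using abc(1) by (simp add: A_def B_def)
  have C_inner: "C \<bullet> C = p + 2 * (A \<bullet> B) + B \<bullet> B" "B \<bullet> C = - (A \<bullet> B) - B \<bullet> B" "A \<bullet> C = - p - A \<bullet> B"
    by (simp_all add: C_def p_def inner_diff_left inner_diff_right inner_commute[of B A])
  have expand: "(v - v') \<bullet> (v - v') = v \<bullet> v - 2 * (v \<bullet> v') + v' \<bullet> v'" for v v' :: "real^2"
    by (simp add: inner_diff_left inner_diff_right inner_commute)
  have BB: "B \<bullet> B = p" and AB: "A \<bullet> B = - p / 2"
    using sq unfolding expand by (simp_all add: C_inner p_def[symmetric] inner_commute[of C A])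
  have p: "0 < p"
    using pos0 BB AB unfolding expand by (simp add: p_def[symmetric])
  have CC: "C \<bullet> C = p" and AC: "A \<bullet> C = - p / 2" and BC: "B \<bullet> C = - p / 2"
    using BB AB by (simp_all add: C_inner)
  define V where "V i = (if i = 1 then A else if i = 2 then B else C)" for i :: 3
  have VV: "V i \<bullet> V j = (if i = j then p else - p / 2)" for i j
    using exhaust_3[of i] exhaust_3[of j] BB AB CC AC BC
    by (auto simp: V_def p_def inner_commute[of B A] inner_commute[of C A] inner_commute[of C B])
  define m where "m i = (1 / sqrt p) *\<^sub>R V i" for i
  define r where "r = sqrt p / 2"
  have half: "m i \<bullet> x + r = (V i \<bullet> x + p / 2) / sqrt p" for i x
    using p by (simp add: m_def r_def field_simps)
  have T_eq: "{x. \<forall>i. 0 \<le> m i \<bullet> (x - z) + r} = {x. \<forall>i. 0 \<le> V i \<bullet> (x - z) + p / 2}"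
    unfolding half using p by (simp add: zero_le_divide_iff)
  have hull: "convex hull {a, b, c} = {x. \<forall>i. 0 \<le> V i \<bullet> (x - z) + p / 2}" (is "_ = ?H")
  proof
    have "convex ?H"
    proof -
      have "?H = (\<Inter>i. {x. V i \<bullet> x \<ge> V i \<bullet> z - p / 2})" by (auto simp: inner_diff_right algebra_simps)
      then show ?thesis by (simp only:) (intro convex_INT convex_halfspace_ge)
    qed
    moreover have "a - z = V 1" "b - z = V 2" "c - z = V 3" by (simp_all add: V_def A_def B_def C)
    then have "{a, b, c} \<subseteq> ?H" using p by (auto simp: VV)
    ultimately show "convex hull {a, b, c} \<subseteq> ?H" by (simp add: hull_minimal)
  next
    show "?H \<subseteq> convex hull {a, b, c}"
    proof
      fix x assume x: "x \<in> ?H"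
      define y where "y = x - z"
      \<comment> \<open>The map \<open>y \<mapsto> (A \<bullet> y) *\<^sub>R A + (B \<bullet> y) *\<^sub>R B + (C \<bullet> y) *\<^sub>R C\<close> is \<open>3/2 p\<close> times the identity; \<open>u\<close> measures the deviation.\<close>
      define u where "u = y - (2 / (3 * p)) *\<^sub>R ((A \<bullet> y) *\<^sub>R A + (B \<bullet> y) *\<^sub>R B + (C \<bullet> y) *\<^sub>R C)"
      have Cy: "C \<bullet> y = - (A \<bullet> y) - B \<bullet> y" by (simp add: C_def inner_diff_left)
      have "u \<bullet> A = A \<bullet> y - 2 / (3 * p) * ((A \<bullet> y) * p + (B \<bullet> y) * (- p / 2) + (C \<bullet> y) * (- p / 2))"
        using AB AC by (simp add: u_def inner_diff_left inner_add_left inner_commute[of C A] inner_commute[of B A]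
            inner_commute[of y] p_def[symmetric])
      moreover have "u \<bullet> B = B \<bullet> y - 2 / (3 * p) * ((A \<bullet> y) * (- p / 2) + (B \<bullet> y) * p + (C \<bullet> y) * (- p / 2))"
        using AB BC BB by (simp add: u_def inner_diff_left inner_add_left inner_commute[of C B] inner_commute[of y])
      ultimately have "u \<bullet> A = 0" "u \<bullet> B = 0"
        using p by (simp_all add: Cy field_simps)
      then have "u = 0" using orthogonal_to_basis_2[OF _ BB AB p] p_def by simp
      then have y: "y = (2 / (3 * p)) *\<^sub>R ((A \<bullet> y) *\<^sub>R A + (B \<bullet> y) *\<^sub>R B + (C \<bullet> y) *\<^sub>R C)" by (simp add: u_def)
      define t where "t i = 2 / (3 * p) * (V i \<bullet> y + p / 2)" for i
      have t0: "0 \<le> t i" for i using x p unfolding t_def y_def by (intro mult_nonneg_nonneg) auto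
      have V123: "V 1 = A" "V 2 = B" "V 3 = C" by (simp_all add: V_def)
      have t1: "t 1 + t 2 + t 3 = 1" using p by (simp add: t_def V123 Cy field_simps)
      have "t 1 *\<^sub>R A + t 2 *\<^sub>R B + t 3 *\<^sub>R C = (2 / (3 * p)) *\<^sub>R ((A \<bullet> y) *\<^sub>R A + (B \<bullet> y) *\<^sub>R B + (C \<bullet> y) *\<^sub>R C) + (1 / 3) *\<^sub>R (A + B + C)"
        using p by (simp add: t_def V123 distrib_left scaleR_add_left scaleR_add_right)
      also have "A + B + C = 0" by (simp add: C_def)
      finally have "y = t 1 *\<^sub>R A + t 2 *\<^sub>R B + t 3 *\<^sub>R C" using y by simp
      then have "x = z + (t 1 *\<^sub>R (a - z) + t 2 *\<^sub>R (b - z) + t 3 *\<^sub>R (c - z))"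
        by (simp add: y_def A_def B_def C algebra_simps)
      also have "\<dots> = t 1 *\<^sub>R a + t 2 *\<^sub>R b + t 3 *\<^sub>R c + (1 - (t 1 + t 2 + t 3)) *\<^sub>R z"
        by (simp add: algebra_simps)
      finally have "x = t 1 *\<^sub>R a + t 2 *\<^sub>R b + t 3 *\<^sub>R c" by (simp add: t1)
      then show "x \<in> convex hull {a, b, c}" unfolding convex_hull_3 using t0 t1 by blast
    qed
  qed
  have tri: "equilateral m z r"
  proof
    show "m i \<bullet> m j = (if i = j then 1 else - 1 / 2)" for i j
      using p by (simp add: m_def VV)
    show "0 < r" using p by (simp add: r_def)
    show "bounded {x. \<forall>i. 0 \<le> m i \<bullet> (x - z) + r}"
      unfolding T_eq hull[symmetric] by (intro bounded_convex_hull) auto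
  qed
  moreover have "equilateral.T m z r = S"
    unfolding equilateral.T_def[OF tri] equilateral.d_def[OF tri] T_eq abc(4) hull ..
  ultimately show ?thesis by (rule that)
qed

lemma L2_on_component_integrable:
  fixes g :: "real^'n \<Rightarrow> real^'m"
  assumes "L2_on D g" "D \<in> lmeasurable"
  shows "integrable (lebesgue_on D) (\<lambda>x. g x $ i)"
proof (rule Bochner_Integration.integrable_bound)
  interpret finite_measure "lebesgue_on D" by (rule finite_measure_lebesgue_on[OF assms(2)])
  show "integrable (lebesgue_on D) (\<lambda>x. 1 + (norm (g x))\<^sup>2)"
    using assms(1) by (auto simp: L2_on_def)
  have [measurable]: "g \<in> borel_measurable (lebesgue_on D)" using assms(1) by (simp add: L2_on_def)
  show "(\<lambda>x. g x $ i) \<in> borel_measurable (lebesgue_on D)" unfolding cart_eq_inner_axis by measurable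
  have "\<bar>g x $ i\<bar> \<le> 1 + (norm (g x))\<^sup>2" for x
  proof -
    have "\<bar>g x $ i\<bar> \<le> norm (g x)" by (rule component_le_norm_cart)
    also have "2 * norm (g x) \<le> 1 + (norm (g x))\<^sup>2"
      using zero_le_power2[of "norm (g x) - 1"] by (simp add: power2_diff)
    then have "norm (g x) \<le> 1 + (norm (g x))\<^sup>2" by (smt (verit) norm_ge_zero)
    finally show ?thesis .
  qed
  then show "AE x in lebesgue_on D. norm (g x $ i) \<le> norm (1 + (norm (g x))\<^sup>2)"
    by (intro AE_I2) (simp add: add_nonneg_nonneg)
qed

theorem theorem1p1:
  fixes T D :: "(real^2) set" and u w :: "real^2 \<Rightarrow> real"
  assumes "equilateral_triangle T" and "D = interior T"
    and "neumann_eigenfunction D u"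
    and "continuous_extension D u w"
    and "\<forall>x\<in>frontier D. w x \<ge> 0"
  shows "\<exists>c. (\<forall>x\<in>D. w x = c) \<and> (AE x in lebesgue_on D. u x = c)"
proof -
  obtain m z r where tri: "equilateral m z r" "equilateral.T m z r = T"
    using equilateral_triangle_normals[OF assms(1)] by metis
  interpret tri: equilateral m z r by (rule tri(1))
  have D_eq: "D = tri.D" and T_eq: "T = tri.T"
    using assms(2) tri(2) tri.interior_T by auto
  note D = tri.D_facts[folded D_eq]
  have cl: "closure D = T" using tri.closure_D by (simp add: D_eq T_eq)
  have fr: "frontier D = T - D" using D(1) by (simp add: frontier_def cl interior_open)
  have w: "continuous_on T w" and wu: "AE x in lebesgue_on D. w x = u x"
    using assms(4) by (auto simp: continuous_extension_def cl)
  obtain g \<mu> where u0: "\<not> (AE x in lebesgue_on D. u x = 0)" and H1: "H1_gradient D u g"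
    and eig: "\<And>v h. H1_gradient D v h \<Longrightarrow> (LINT x|lebesgue_on D. g x \<bullet> h x) = \<mu> * (LINT x|lebesgue_on D. u x * v x)"
    using assms(3) unfolding neumann_eigenfunction_def by blast
  have um [measurable]: "u \<in> borel_measurable (lebesgue_on D)" and L2g: "L2_on D g" and wgu: "weak_gradient D u g"
    using H1 by (auto simp: H1_gradient_def L2_on_def)
  have wi: "integrable (lebesgue_on D) w" using tri.integrable_T[of w] w by (simp add: T_eq D_eq)
  have wm [measurable]: "w \<in> borel_measurable (lebesgue_on D)" using wi by auto
  have gm [measurable]: "g \<in> borel_measurable (lebesgue_on D)" using L2g by (simp add: L2_on_def)
  have gi: "integrable (lebesgue_on D) (\<lambda>x. g x $ i)" for i
    by (rule L2_on_component_integrable[OF L2g D(5)])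
  have wu_int: "(LINT x|lebesgue_on D. u x * f x) = (LINT x|lebesgue_on D. w x * f x)"
    if [measurable]: "f \<in> borel_measurable (lebesgue_on D)" for f
    by (rule integral_cong_AE) (use wu in auto)
  have wg: "weak_gradient D w g"
    unfolding weak_gradient_def
  proof (intro allI impI)
    fix \<phi> :: "real^2 \<Rightarrow> real" and i assume \<phi>: "test_function D \<phi>"
    then have "partial i \<phi> \<in> borel_measurable (lebesgue_on D)"
      by (intro smooth_measurable smooth_partial smooth_test_function D)
    from wu_int[OF this] show "(LINT x|lebesgue_on D. w x * partial i \<phi> x) = - (LINT x|lebesgue_on D. g x $ i * \<phi> x)"
      using wgu \<phi> by (simp add: weak_gradient_def)
  qed
  have eig_smooth: "(LINT x|lebesgue_on D. g x \<bullet> gradient v x) = \<mu> * (LINT x|lebesgue_on D. w x * v x)"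
    if "smooth v" for v
    using eig[OF H1_gradient_smooth[OF that D(3,4)]] wu_int[OF smooth_measurable[OF that D(4)]] by simp
  show ?thesis
  proof (cases "0 < \<mu>")
    case True
    have zero: "w x = 0" if "x \<in> T - D" for x
      using tri.boundary_zero[of w g \<mu> x] w wg gi eig_smooth True assms(5) fr that
      unfolding D_eq T_eq by blast
    have "(LINT x|lebesgue_on D. w x * exp (\<xi> \<bullet> x)) = 0" for \<xi>
    proof -
      let ?E = "\<lambda>x. exp (x \<bullet> \<xi>)"
      have sE: "smooth ?E" by (intro smooth_exp smooth_inner)
      have dE: "dirderiv e ?E x = (e \<bullet> \<xi>) * ?E x" for e x
        by (rule dirderiv_eq[where f' = "\<lambda>e. ?E x * (e \<bullet> \<xi>)", THEN trans])
           (auto intro!: derivative_eq_intros)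
      have ge: "integrable (lebesgue_on D) (\<lambda>x. g x \<bullet> \<xi>)"
        unfolding inner_vec_def using gi by simp
      have "0 = (LINT x|lebesgue_on D. w x * dirderiv \<xi> ?E x + (g x \<bullet> \<xi>) * ?E x)"
        using tri.integral_product_rule_boundary_zero[of w g ?E \<xi>] w wg gi sE zero
        unfolding D_eq T_eq by simp
      also have "\<dots> = (LINT x|lebesgue_on D. (\<xi> \<bullet> \<xi>) * (w x * ?E x) + g x \<bullet> gradient ?E x)"
        by (simp add: dE inner_gradient[OF sE] mult_ac)
      also have "\<dots> = (\<xi> \<bullet> \<xi>) * (LINT x|lebesgue_on D. w x * ?E x) + (LINT x|lebesgue_on D. g x \<bullet> gradient ?E x)"
      proof -
        have "integrable (lebesgue_on D) (\<lambda>x. w x * ?E x)"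
          by (rule integrable_mult_smooth[OF wi sE D(3,4)])
        moreover have "integrable (lebesgue_on D) (\<lambda>x. g x \<bullet> gradient ?E x)"
          using integrable_mult_smooth[OF ge sE D(3,4)] by (simp add: inner_gradient[OF sE] dE)
        ultimately show ?thesis by simp
      qed
      also have "\<dots> = (\<xi> \<bullet> \<xi> + \<mu>) * (LINT x|lebesgue_on D. w x * ?E x)"
        by (simp add: eig_smooth[OF sE] distrib_right)
      finally have "(\<xi> \<bullet> \<xi> + \<mu>) * (LINT x|lebesgue_on D. w x * ?E x) = 0" by simp
      moreover have "0 < \<xi> \<bullet> \<xi> + \<mu>" using True by (intro add_nonneg_pos) auto
      ultimately show ?thesis by (simp add: inner_commute)
    qed
    then have "AE x in lebesgue_on D. w x = 0"
      using orthogonal_to_exponentials_imp_AE_zero[OF _ w, of D] tri.compact_T tri.D_subset_T D(5)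
      by (simp add: T_eq D_eq)
    with wu have "AE x in lebesgue_on D. u x = 0" by eventually_elim simp
    with u0 show ?thesis by contradiction
  next
    case False
    have gg: "integrable (lebesgue_on D) (\<lambda>x. g x \<bullet> g x)"
      using L2g by (simp add: L2_on_def power2_norm_eq_inner)
    have "0 \<le> (LINT x|lebesgue_on D. u x * u x)" by (rule integral_nonneg_AE) simp
    then have "(LINT x|lebesgue_on D. g x \<bullet> g x) \<le> 0"
      using eig[OF H1] False by (simp add: mult_nonpos_nonneg)
    moreover have "0 \<le> (LINT x|lebesgue_on D. g x \<bullet> g x)" by (rule integral_nonneg_AE) simp
    ultimately have "AE x in lebesgue_on D. g x \<bullet> g x = 0"
      using integral_nonneg_eq_0_iff_AE[OF gg] by simp
    then have g0: "AE x in lebesgue_on D. g x = 0" by simp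
    have "weak_gradient D w (\<lambda>_. 0)"
      unfolding weak_gradient_def
    proof (intro allI impI)
      fix \<phi> :: "real^2 \<Rightarrow> real" and i assume \<phi>: "test_function D \<phi>"
      have "(LINT x|lebesgue_on D. g x $ i * \<phi> x) = 0"
        by (rule integral_eq_zero_AE) (use g0 in auto)
      then show "(LINT x|lebesgue_on D. w x * partial i \<phi> x) = - (LINT x|lebesgue_on D. (0::real^2) $ i * \<phi> x)"
        using wg \<phi> by (simp add: weak_gradient_def)
    qed
    then have const: "w p = w q" if "p \<in> D" "q \<in> D" for p q
      using weak_gradient_zero_imp_constant[OF D(1-3) _ wi] w continuous_on_subset tri.D_subset_T that
      unfolding D_eq T_eq by metis
    obtain p where p: "p \<in> D" using D(6) by blast
    have "AE x in lebesgue_on D. u x = w p"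
      using wu AE_space
    proof eventually_elim
      case (elim x)
      then show ?case using const[OF _ p, of x] by simp
    qed
    then show ?thesis using const p by blast
  qed
qed

end
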